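(* Let $G$ be a compact metric tree. If the multiplicity of $\lambda_2(G,0)$ is at least two, then for any $M>0$ the potential $q=0$ does not minimize $\Gamma[q]$ in $C_{G,M}$.
   Context: A compact metric graph consists of finitely many edges, each identified with a compact interval $[0,|e|]$, $|e|>0$, whose endpoints are partitioned into finitely many classes (vertices) and glued accordingly; it is always assumed connected. A tree is a connected metric graph without cycles; a leaf is a vertex of degree one, and the boundary of a tree is the set of its leaves. For a real potential $q$ on $G$, $H u=-u''+qu$ is the self-adjoint Schrödinger operator on $L^2(G)$ with standard (Kirchhoff) vertex conditions: continuity at each vertex and, at each vertex, the sum of the normal derivatives along all incident edges equals $0$. Its eigenvalues counted with multiplicity are $\lambda_1(G,q)<\lambda_2(G,q)\le\dots$, and $\Gamma[q]=\lambda_2(G,q)-\lambda_1(G,q)$. For a tree $G$ and $M>0$, $C_{G,M}$ is the set of functions $q:G\to\mathbb{R}$ with $0\le q(x)\le M$ for all $x\in G$ such that $q$ is convex on every path in $G$ from one boundary vertex (leaf) to another, each path being regarded as an interval. *)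

theory Defs
  imports "HOL-Analysis.Analysis" "HOL-Library.Function_Algebras"
begin

text \<open>
  Edge \<open>e\<close> is the interval \<open>[0, elen G e]\<close>; \<open>src\<close> and \<open>tgt\<close> send its endpoints \<open>0\<close> and
  \<open>elen G e\<close> to their gluing classes. The orientation only fixes a coordinate; loops and
  parallel edges are allowed.
\<close>

record ('v, 'e) metric_graph =
  edges :: "'e set"
  elen :: "'e \<Rightarrow> real"
  src :: "'e \<Rightarrow> 'v"
  tgt :: "'e \<Rightarrow> 'v"

definition vertices :: "('v, 'e) metric_graph \<Rightarrow> 'v set" where
  "vertices G = src G ` edges G \<union> tgt G ` edges G"

text \<open>A pair \<open>(e, True)\<close> is the edge \<open>e\<close> traversed from source to target, \<open>(e, False)\<close> its reversal.\<close>

definition dstart :: "('v, 'e) metric_graph \<Rightarrow> 'e \<times> bool \<Rightarrow> 'v" where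
  "dstart G a = (if snd a then src G (fst a) else tgt G (fst a))"

definition dstop :: "('v, 'e) metric_graph \<Rightarrow> 'e \<times> bool \<Rightarrow> 'v" where
  "dstop G a = (if snd a then tgt G (fst a) else src G (fst a))"

fun walk :: "('v, 'e) metric_graph \<Rightarrow> 'v \<Rightarrow> ('e \<times> bool) list \<Rightarrow> 'v \<Rightarrow> bool" where
  "walk G v [] w \<longleftrightarrow> v \<in> vertices G \<and> v = w"
| "walk G v (a # p) w \<longleftrightarrow> fst a \<in> edges G \<and> dstart G a = v \<and> walk G (dstop G a) p w"

definition simple_walk :: "('v, 'e) metric_graph \<Rightarrow> 'v \<Rightarrow> ('e \<times> bool) list \<Rightarrow> 'v \<Rightarrow> bool" where
  "simple_walk G v p w \<longleftrightarrow> walk G v p w \<and> distinct (v # map (dstop G) p)"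

text \<open>The edges are required to be distinct so that going back and forth along one edge is no cycle.\<close>

definition cycle_at :: "('v, 'e) metric_graph \<Rightarrow> 'v \<Rightarrow> ('e \<times> bool) list \<Rightarrow> bool" where
  "cycle_at G v p \<longleftrightarrow>
     walk G v p v \<and> p \<noteq> [] \<and> distinct (map fst p) \<and> distinct (map (dstart G) p)"

definition compact_metric_graph :: "('v, 'e) metric_graph \<Rightarrow> bool" where
  "compact_metric_graph G \<longleftrightarrow>
     finite (edges G) \<and> edges G \<noteq> {} \<and> (\<forall>e\<in>edges G. 0 < elen G e) \<and>
     (\<forall>v\<in>vertices G. \<forall>w\<in>vertices G. \<exists>p. walk G v p w)"

definition metric_tree :: "('v, 'e) metric_graph \<Rightarrow> bool" where
  "metric_tree G \<longleftrightarrow> compact_metric_graph G \<and> (\<nexists>v p. cycle_at G v p)"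

definition vertex_degree :: "('v, 'e) metric_graph \<Rightarrow> 'v \<Rightarrow> nat" where
  "vertex_degree G v = card {e \<in> edges G. src G e = v} + card {e \<in> edges G. tgt G e = v}"

definition leaves :: "('v, 'e) metric_graph \<Rightarrow> 'v set" where
  "leaves G = {v \<in> vertices G. vertex_degree G v = 1}"

text \<open>
  A function on \<open>G\<close> is represented by a function of pairs \<open>(e, x)\<close> with \<open>x \<in> [0, elen G e]\<close>
  that is compatible with the gluing; values outside \<open>graph_points G\<close> carry no meaning.
\<close>

definition graph_points :: "('v, 'e) metric_graph \<Rightarrow> ('e \<times> real) set" where
  "graph_points G = (SIGMA e : edges G. {0..elen G e})"

definition glued :: "('v, 'e) metric_graph \<Rightarrow> ('e \<times> real \<Rightarrow> real) \<Rightarrow> bool" where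
  "glued G f \<longleftrightarrow>
     (\<exists>\<phi>. \<forall>e\<in>edges G. f (e, 0) = \<phi> (src G e) \<and> f (e, elen G e) = \<phi> (tgt G e))"

definition square_integrable :: "real set \<Rightarrow> (real \<Rightarrow> real) \<Rightarrow> bool" where
  "square_integrable S f \<longleftrightarrow>
     f \<in> borel_measurable (lebesgue_on S) \<and> integrable (lebesgue_on S) (\<lambda>x. (f x)\<^sup>2)"

text \<open>
  \<open>f\<close> lies in the Sobolev space \<open>H\<^sup>2(0, L)\<close>, with first derivative \<open>f1\<close> (the absolutely
  continuous representative) and weak second derivative \<open>f2\<close>.
\<close>

definition H2_on :: "real \<Rightarrow> (real \<Rightarrow> real) \<Rightarrow> (real \<Rightarrow> real) \<Rightarrow> (real \<Rightarrow> real) \<Rightarrow> bool" where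
  "H2_on L f f1 f2 \<longleftrightarrow>
     (\<forall>x\<in>{0..L}. (f has_real_derivative f1 x) (at x within {0..L})) \<and>
     square_integrable {0..L} f2 \<and>
     (\<forall>x\<in>{0..L}. f1 x = f1 0 + integral {0..x} f2)"

text \<open>
  Derivatives into the edges at a vertex; a loop contributes at both of its ends.
\<close>

definition normal_derivative_sum :: "('v, 'e) metric_graph \<Rightarrow> ('e \<times> real \<Rightarrow> real) \<Rightarrow> 'v \<Rightarrow> real" where
  "normal_derivative_sum G u1 v =
     (\<Sum>e | e \<in> edges G \<and> src G e = v. u1 (e, 0)) +
     (\<Sum>e | e \<in> edges G \<and> tgt G e = v. - u1 (e, elen G e))"

text \<open>
  The graph of \<open>H u = - u'' + q u\<close> on (real) \<open>L\<^sup>2(G)\<close> with standard vertex conditions. An element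
  of the domain is identified with its continuous representative, extended by \<open>0\<close> off
  \<open>graph_points G\<close> so that it is determined uniquely; the image \<open>h\<close> is only determined almost
  everywhere.
\<close>

definition schroedinger ::
  "('v, 'e) metric_graph \<Rightarrow> ('e \<times> real \<Rightarrow> real) \<Rightarrow> (('e \<times> real \<Rightarrow> real) \<times> ('e \<times> real \<Rightarrow> real)) set" where
  "schroedinger G q = {(u, h).
     (\<forall>p. p \<notin> graph_points G \<longrightarrow> u p = 0) \<and>
     glued G u \<and>
     (\<forall>e\<in>edges G. square_integrable {0..elen G e} (\<lambda>x. h (e, x))) \<and>
     (\<exists>u1 u2.
        (\<forall>e\<in>edges G.
           H2_on (elen G e) (\<lambda>x. u (e, x)) (\<lambda>x. u1 (e, x)) (\<lambda>x. u2 (e, x)) \<and>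
           (AE x in lebesgue_on {0..elen G e}. h (e, x) = - u2 (e, x) + q (e, x) * u (e, x))) \<and>
        (\<forall>v\<in>vertices G. normal_derivative_sum G u1 v = 0))}"

definition eigenspace ::
  "('v, 'e) metric_graph \<Rightarrow> ('e \<times> real \<Rightarrow> real) \<Rightarrow> real \<Rightarrow> ('e \<times> real \<Rightarrow> real) set" where
  "eigenspace G q \<mu> = {u. (u, \<lambda>p. \<mu> * u p) \<in> schroedinger G q}"

interpretation real_fun: vector_space "\<lambda>(c::real) (f::'a \<Rightarrow> real) x. c * f x"
  by unfold_locales (auto simp: algebra_simps fun_eq_iff)

definition eigen_mult :: "('v, 'e) metric_graph \<Rightarrow> ('e \<times> real \<Rightarrow> real) \<Rightarrow> real \<Rightarrow> nat" where
  "eigen_mult G q \<mu> = real_fun.dim (eigenspace G q \<mu>)"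

text \<open>
  \<open>\<lambda>\<^sub>k(G, q)\<close>: the smallest \<open>t\<close> such that at least \<open>k\<close> eigenvalues, counted with multiplicity,
  are at most \<open>t\<close>. An eigenvalue \<open>\<mu>\<close> of multiplicity \<open>m\<close> is counted as \<open>(\<mu>, 0), \<dots>, (\<mu>, m - 1)\<close>.
\<close>

definition eigenvals_upto :: "('v, 'e) metric_graph \<Rightarrow> ('e \<times> real \<Rightarrow> real) \<Rightarrow> real \<Rightarrow> (real \<times> nat) set" where
  "eigenvals_upto G q t = {(\<mu>, i). \<mu> \<le> t \<and> i < eigen_mult G q \<mu>}"

definition eigenval :: "('v, 'e) metric_graph \<Rightarrow> ('e \<times> real \<Rightarrow> real) \<Rightarrow> nat \<Rightarrow> real" where
  "eigenval G q k = Inf {t. \<exists>A \<subseteq> eigenvals_upto G q t. finite A \<and> card A = k}"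

text \<open>
  Hence, whenever \<open>lam 0 \<le> lam 1 \<le> \<dots>\<close> lists all eigenvalues, each repeated according to its
  multiplicity, \<open>eigenval G q (k + 1)\<close> is \<open>lam k\<close>.
\<close>

lemma eigenval_eq_enumeration:
  fixes lam :: "nat \<Rightarrow> real"
  assumes mono: "mono lam"
    and fin: "\<And>\<mu>. finite {n. lam n = \<mu>}"
    and mult: "\<And>\<mu>. card {n. lam n = \<mu>} = eigen_mult G q \<mu>"
  shows "eigenval G q (Suc k) = lam k"
proof -
  let ?S = "{t. \<exists>A \<subseteq> eigenvals_upto G q t. finite A \<and> card A = Suc k}"
  define g where "g n = (lam n, card {m. m < n \<and> lam m = lam n})" for n
  have strict: "card {m. m < n \<and> lam m = c} < card {m. m < n' \<and> lam m = c}"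
    if "n < n'" "lam n = c" for n n' c
    by (rule psubset_card_mono) (use that in auto)
  have "inj g"
  proof (rule injI)
    fix a b assume "g a = g b"
    then have *: "lam a = lam b"
        "card {m. m < a \<and> lam m = lam b} = card {m. m < b \<and> lam m = lam b}"
      by (auto simp: g_def)
    show "a = b"
      using strict[of a b "lam b"] strict[of b a "lam b"] * by (cases a b rule: linorder_cases) auto
  qed
  have upper: "g n \<in> eigenvals_upto G q (lam k)" if "n \<le> k" for n
  proof -
    have "card {m. m < n \<and> lam m = lam n} < card {m. lam m = lam n}"
      by (rule psubset_card_mono) (use fin in auto)
    then show ?thesis
      using that mono by (auto simp: eigenvals_upto_def g_def mult monoD)
  qed
  have "lam k \<in> ?S"
    using upper \<open>inj g\<close>
    by (auto intro!: exI[of _ "g ` {..k}"] simp: card_image inj_on_subset)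
  moreover have "lam k \<le> t" if "t \<in> ?S" for t
  proof (rule ccontr)
    assume "\<not> lam k \<le> t"
    then have J: "{n. lam n \<le> t} \<subseteq> {..<k}"
      using mono by (auto simp: monoD not_less) (meson monoD not_le order_trans)
    then have finJ: "finite {n. lam n \<le> t}" by (rule finite_subset) simp
    have eq: "eigenvals_upto G q t = (SIGMA \<mu> : lam ` {n. lam n \<le> t}. {..<eigen_mult G q \<mu>})"
    proof -
      have "\<exists>n. lam n = \<mu>" if "i < eigen_mult G q \<mu>" for \<mu> i
      proof -
        have "{n. lam n = \<mu>} \<noteq> {}" using that mult[of \<mu>] by (metis card.empty not_less_zero)
        then show ?thesis by blast
      qed
      then show ?thesis unfolding eigenvals_upto_def by blast
    qed
    have "card (eigenvals_upto G q t) = (\<Sum>\<mu>\<in>lam ` {n. lam n \<le> t}. card {n. lam n = \<mu>})"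
      unfolding eq using finJ by (subst card_SigmaI) (auto simp: mult)
    also have "\<dots> = card (\<Union>\<mu>\<in>lam ` {n. lam n \<le> t}. {n. lam n = \<mu>})"
      by (rule card_UN_disjoint[symmetric]) (use finJ fin in auto)
    also have "(\<Union>\<mu>\<in>lam ` {n. lam n \<le> t}. {n. lam n = \<mu>}) = {n. lam n \<le> t}" by auto
    also have "card \<dots> \<le> k" using card_mono[OF _ J] by simp
    finally have "card (eigenvals_upto G q t) \<le> k" .
    moreover have "finite (eigenvals_upto G q t)" unfolding eq using finJ by auto
    ultimately have "card A \<le> k" if "A \<subseteq> eigenvals_upto G q t" for A
      using card_mono[OF _ that] by linarith
    moreover obtain A where "A \<subseteq> eigenvals_upto G q t" "card A = Suc k"
      using \<open>t \<in> ?S\<close> by blast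
    ultimately show False by (metis not_less_eq_eq le_refl)
  qed
  ultimately show ?thesis
    unfolding eigenval_def by (rule cInf_eq_minimum)
qed

definition spectral_gap :: "('v, 'e) metric_graph \<Rightarrow> ('e \<times> real \<Rightarrow> real) \<Rightarrow> real" where
  "spectral_gap G q = eigenval G q 2 - eigenval G q 1"

definition walk_length :: "('v, 'e) metric_graph \<Rightarrow> ('e \<times> bool) list \<Rightarrow> real" where
  "walk_length G p = (\<Sum>a\<leftarrow>p. elen G (fst a))"

text \<open>The point at distance \<open>t\<close> from the start of a walk, for \<open>0 \<le> t \<le> walk_length G p\<close>.\<close>

fun walk_point :: "('v, 'e) metric_graph \<Rightarrow> ('e \<times> bool) list \<Rightarrow> real \<Rightarrow> 'e \<times> real" where
  "walk_point G [] t = undefined"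
| "walk_point G (a # p) t =
     (let l = elen G (fst a) in
      if t \<le> l then (fst a, if snd a then t else l - t) else walk_point G p (t - l))"

definition convex_potentials :: "('v, 'e) metric_graph \<Rightarrow> real \<Rightarrow> ('e \<times> real \<Rightarrow> real) set" where
  "convex_potentials G M = {q.
     glued G q \<and>
     (\<forall>x\<in>graph_points G. 0 \<le> q x \<and> q x \<le> M) \<and>
     (\<forall>v\<in>leaves G. \<forall>w\<in>leaves G. \<forall>p. v \<noteq> w \<and> simple_walk G v p w \<longrightarrow>
        convex_on {0..walk_length G p} (\<lambda>t. q (walk_point G p t)))}"

lemma zero_in_convex_potentials: "0 \<le> M \<Longrightarrow> (\<lambda>_. 0) \<in> convex_potentials G M"
  by (auto simp: convex_potentials_def glued_def convex_on_def)

end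

theory Submission
  imports Defs "HOL-Real_Asymp.Real_Asymp"
begin

text \<open>
  Let \<open>\<Lambda> = \<lambda>\<^sub>2(G, 0)\<close> and let \<open>z\<close> be a leaf. As \<open>\<Lambda>\<close> has multiplicity at least two, some eigenfunction
  \<open>u \<noteq> 0\<close> for \<open>\<Lambda>\<close> vanishes at \<open>z\<close>. The vertex condition at a leaf makes its derivative vanish there
  too, so \<open>u\<close> is zero on the whole edge at \<open>z\<close>. Hence \<open>u\<close> remains an eigenfunction for \<open>\<Lambda>\<close> when a
  potential \<open>q\<close> supported on that edge is added, while the lowest eigenvalue rises strictly above \<open>0\<close>:
  adding such a \<open>q\<close> shrinks the gap. If \<open>q\<close>, as a function of the distance from the inner vertex of
  the edge, is convex, nondecreasing and starts at \<open>0\<close>, then it is convex on every path between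
  leaves, because such a path meets the edge only as its first or its last piece.

  For \<open>\<lambda>\<^sub>2(G, q) \<le> \<Lambda>\<close> one needs an eigenvalue of \<open>q\<close> below \<open>\<Lambda>\<close>. No general existence theorem is used
  for it: the potential is built together with its ground state. Fix a small \<open>\<nu> = k\<^sup>2\<close>. Off the
  pendant edge the ground state is to solve \<open>- f'' = \<nu> f\<close>, so it interpolates its vertex values by
  sines, and the vertex conditions away from \<open>z\<close> are a homogeneous linear system with one equation
  fewer than unknowns (\<open>sine_network_nontrivial\<close>). An energy identity shows that a solution is
  nearly constant for small \<open>k\<close> (\<open>low_frequency_network\<close>), hence positive. On the pendant edge the
  logarithmic derivative \<open>m = f' / f\<close> is prescribed as a cubic polynomial that matches the rest of the
  graph at the inner vertex and vanishes at \<open>z\<close>, and the Riccati equation \<open>q = m' + m\<^sup>2 + \<nu>\<close> then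
  defines the potential (\<open>pendant_edge_potential\<close>).

  Picone's identity (\<open>eigenfunction_below_ground_state\<close>) shows that an eigenvalue with a positive
  eigenfunction is the lowest one, so \<open>\<lambda>\<^sub>1(G, q) = \<nu> > 0 = \<lambda>\<^sub>1(G, 0)\<close>. The same identity, applied to the
  constant function, gives \<open>\<Lambda> > 0\<close>.
\<close>

section \<open>Walks and leaves\<close>

lemma walk_in_vertices:
  "walk G v p w \<Longrightarrow> v \<in> vertices G \<and> w \<in> vertices G"
  by (induction p arbitrary: v) (auto simp: vertices_def dstart_def)

lemma walk_append:
  "walk G v (p @ r) w \<longleftrightarrow> (\<exists>x. walk G v p x \<and> walk G x r w)"
  by (induction p arbitrary: v) (auto dest: walk_in_vertices)

lemma walk_dstop_in_vertices:
  "walk G v p w \<Longrightarrow> a \<in> set p \<Longrightarrow> fst a \<in> edges G \<and> dstop G a \<in> vertices G"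
  by (induction p arbitrary: v) (auto dest: walk_in_vertices)

lemma walk_dstart_mem:
  "walk G v p w \<Longrightarrow> a \<in> set p \<Longrightarrow> dstart G a \<in> set (v # map (dstop G) p)"
  by (induction p arbitrary: v) auto

lemma map_dstart_walk:
  "walk G v p w \<Longrightarrow> map (dstart G) p = butlast (v # map (dstop G) p)"
  by (induction p arbitrary: v) auto

lemma same_edge_ends:
  "fst a = fst b \<Longrightarrow> {dstart G a, dstop G a} = {dstart G b, dstop G b}"
  by (auto simp: dstart_def dstop_def)

lemma simple_walk_Cons:
  "simple_walk G v (a # p) w \<longleftrightarrow>
     fst a \<in> edges G \<and> dstart G a = v \<and> v \<notin> set (dstop G a # map (dstop G) p) \<and>
     simple_walk G (dstop G a) p w"
  by (auto simp: simple_walk_def)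

lemma simple_walk_start_fresh:
  assumes "simple_walk G v (a # p) w" "b \<in> set p"
  shows "v \<notin> {dstart G b, dstop G b}"
proof -
  have "walk G (dstop G a) p w" "v \<notin> set (dstop G a # map (dstop G) p)"
    using assms by (auto simp: simple_walk_def)
  with walk_dstart_mem[of G "dstop G a" p w b] assms(2) show ?thesis by auto
qed

lemma simple_walk_distinct_edges:
  "simple_walk G v p w \<Longrightarrow> distinct (map fst p)"
proof (induction p arbitrary: v)
  case (Cons a p)
  have "fst b \<noteq> fst a" if "b \<in> set p" for b
    using simple_walk_start_fresh[OF Cons.prems that] same_edge_ends[of b a G] Cons.prems
    by (auto simp: simple_walk_Cons)
  moreover have "distinct (map fst p)"
    using Cons by (auto simp: simple_walk_Cons)
  ultimately show ?case by force
qed simp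

lemma finite_vertices: "compact_metric_graph G \<Longrightarrow> finite (vertices G)"
  by (auto simp: compact_metric_graph_def vertices_def)

lemma simple_walk_length:
  assumes "compact_metric_graph G" "simple_walk G v p w"
  shows "length p < card (vertices G)"
proof -
  have wk: "walk G v p w" and d: "distinct (v # map (dstop G) p)"
    using assms(2) by (auto simp: simple_walk_def)
  have "set (v # map (dstop G) p) \<subseteq> vertices G"
    using walk_in_vertices[OF wk] walk_dstop_in_vertices[OF wk] by auto
  from card_mono[OF finite_vertices[OF assms(1)] this] distinct_card[OF d]
  show ?thesis by simp
qed

lemma non_leaf_other_edge:
  assumes "fst a \<in> edges G" "finite (edges G)" "dstart G a = v" "dstop G a \<noteq> v" "v \<notin> leaves G"
  obtains b where "fst b \<in> edges G" "fst b \<noteq> fst a" "dstop G b = v"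
proof -
  have v: "v \<in> vertices G" using assms by (auto simp: vertices_def dstart_def)
  have "\<exists>e\<in>edges G. e \<noteq> fst a \<and> (src G e = v \<or> tgt G e = v)"
  proof (rule ccontr)
    assume "\<not> ?thesis"
    then have "{e \<in> edges G. src G e = v} = (if snd a then {fst a} else {})"
      "{e \<in> edges G. tgt G e = v} = (if snd a then {} else {fst a})"
      using assms(1,3,4) by (auto simp: dstart_def dstop_def split: if_splits)
    then have "vertex_degree G v = 1" by (simp add: vertex_degree_def)
    with v assms(5) show False by (simp add: leaves_def)
  qed
  then obtain e where e: "e \<in> edges G" "e \<noteq> fst a" "src G e = v \<or> tgt G e = v" by auto
  show ?thesis
    using that[of "(e, tgt G e = v)"] e by (auto simp: dstop_def)
qed

text \<open>
  The cycle runs along \<open>b\<close> to the start of the walk and then along the walk until it is back at the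
  start of \<open>b\<close>.
\<close>

lemma simple_walk_chord_cycle:
  assumes p: "simple_walk G v (a # p) w"
    and b: "fst b \<in> edges G" "fst b \<noteq> fst a" "dstop G b = v"
    and x: "dstart G b \<in> set (v # map (dstop G) (a # p))"
  shows "\<exists>r. cycle_at G (dstart G b) r"
proof (cases "dstart G b = v")
  case True
  then have "cycle_at G (dstart G b) [b]"
    using b by (auto simp: cycle_at_def vertices_def dstop_def dstart_def split: if_splits)
  then show ?thesis ..
next
  case False
  then have "dstart G b \<in> dstop G ` set (a # p)" using x by simp
  then obtain c where "c \<in> set (a # p)" "dstop G c = dstart G b" by (metis imageE)
  then obtain p1 p2 where p12: "a # p = p1 @ c # p2" "dstop G c = dstart G b"
    by (meson split_list)
  have wk: "walk G v (p1 @ [c]) (dstart G b)"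
    and dist: "distinct (v # map (dstop G) (p1 @ [c]))" and dist': "distinct (map fst (p1 @ [c]))"
  proof -
    have "simple_walk G v (p1 @ c # p2) w" using p p12 by simp
    then show "walk G v (p1 @ [c]) (dstart G b)" "distinct (v # map (dstop G) (p1 @ [c]))"
      "distinct (map fst (p1 @ [c]))"
      using simple_walk_distinct_edges[of G v "p1 @ c # p2" w] p12
      by (auto simp: simple_walk_def walk_append dest: walk_in_vertices)
  qed
  have new: "fst b \<notin> fst ` set (p1 @ [c])"
  proof
    assume "fst b \<in> fst ` set (p1 @ [c])"
    then obtain a' where a': "a' \<in> set (p1 @ [c])" "fst a' = fst b" by (metis imageE)
    then have "a' \<in> set p" using p12 b(2) by (metis Un_iff append_Cons append_Nil append_assoc
      in_set_conv_decomp set_ConsD set_append)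
    then have "v \<notin> {dstart G a', dstop G a'}" using simple_walk_start_fresh[OF p] by blast
    with same_edge_ends[OF a'(2), of G] b(3) show False by auto
  qed
  have "map (dstart G) (p1 @ [c]) = v # map (dstop G) p1 \<or> p1 @ [c] = []"
    using map_dstart_walk[OF wk] by (simp add: butlast_append)
  then have "map (dstart G) (p1 @ [c]) = v # map (dstop G) p1" by simp
  then have "cycle_at G (dstart G b) (b # p1 @ [c])"
    using wk b dist dist' new p12(2) False by (auto simp: cycle_at_def)
  then show ?thesis ..
qed

text \<open>
  If there were no leaf, every simple walk could be prolonged at its start: the first vertex has a
  second edge, which leads off the walk as it would close a cycle otherwise. But the number of
  vertices bounds the length of simple walks.
\<close>

lemma metric_tree_has_leaf:
  assumes "metric_tree G"
  obtains v where "v \<in> leaves G"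
proof (rule ccontr)
  assume "\<not> thesis"
  then have noleaf: "v \<notin> leaves G" for v using that by blast
  have G: "compact_metric_graph G" and nc: "\<And>v p. \<not> cycle_at G v p"
    using assms by (auto simp: metric_tree_def)
  have fin: "finite (edges G)" using G by (simp add: compact_metric_graph_def)
  have long: "\<exists>v a p w. simple_walk G v (a # p) w \<and> length p = n" for n
  proof (induction n)
    case 0
    obtain e where e: "e \<in> edges G" using G by (auto simp: compact_metric_graph_def)
    have "src G e \<noteq> tgt G e"
      using nc[of "src G e" "[(e, True)]"] e by (auto simp: cycle_at_def dstart_def dstop_def vertices_def)
    then have "simple_walk G (src G e) [(e, True)] (tgt G e)"
      using e by (auto simp: simple_walk_def dstart_def dstop_def vertices_def)
    then show ?case by fastforce
  next
    case (Suc n)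
    then obtain v a p w where p: "simple_walk G v (a # p) w" "length p = n" by blast
    obtain b where b: "fst b \<in> edges G" "fst b \<noteq> fst a" "dstop G b = v"
    proof (rule non_leaf_other_edge[of a G v])
      show "dstop G a \<noteq> v" using p(1) by (auto simp: simple_walk_Cons)
    qed (use fin noleaf p(1) in \<open>auto simp: simple_walk_Cons\<close>)
    have "dstart G b \<notin> set (v # map (dstop G) (a # p))"
      using simple_walk_chord_cycle[OF p(1) b] nc by blast
    then have "simple_walk G (dstart G b) (b # a # p) w"
      using b p by (auto simp: simple_walk_Cons)
    then show ?case using p(2) by fastforce
  qed
  from long[of "card (vertices G)"] simple_walk_length[OF G] show False by fastforce
qed

text \<open>
  The edge is directed so that it ends at its leaf \<open>dstop G a\<close>.
\<close>

definition pendant_edge :: "('v, 'e) metric_graph \<Rightarrow> 'e \<times> bool \<Rightarrow> bool" where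
  "pendant_edge G a \<longleftrightarrow> fst a \<in> edges G \<and> dstart G a \<noteq> dstop G a \<and>
     {e \<in> edges G. src G e = dstop G a} = (if snd a then {} else {fst a}) \<and>
     {e \<in> edges G. tgt G e = dstop G a} = (if snd a then {fst a} else {})"

lemma leaf_pendant_edge:
  assumes "v \<in> leaves G" "finite (edges G)"
  obtains a where "pendant_edge G a" "dstop G a = v"
proof -
  have d: "card {e \<in> edges G. src G e = v} + card {e \<in> edges G. tgt G e = v} = 1"
    using assms by (auto simp: leaves_def vertex_degree_def)
  then consider "card {e \<in> edges G. src G e = v} = 0" "card {e \<in> edges G. tgt G e = v} = 1"
    | "card {e \<in> edges G. src G e = v} = 1" "card {e \<in> edges G. tgt G e = v} = 0"
    by linarith
  then show ?thesis
  proof cases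
    case 1
    then obtain e where "{e \<in> edges G. tgt G e = v} = {e}" "{e \<in> edges G. src G e = v} = {}"
      using assms(2) by (auto simp: card_1_singleton_iff)
    then show ?thesis using that[of "(e, True)"] by (auto simp: pendant_edge_def dstart_def dstop_def)
  next
    case 2
    then obtain e where "{e \<in> edges G. src G e = v} = {e}" "{e \<in> edges G. tgt G e = v} = {}"
      using assms(2) by (auto simp: card_1_singleton_iff)
    then show ?thesis using that[of "(e, False)"] by (auto simp: pendant_edge_def dstart_def dstop_def)
  qed
qed

lemma pendant_edge_at_leaf:
  assumes "pendant_edge G a" "fst b \<in> edges G"
  shows "dstart G b = dstop G a \<Longrightarrow> b = (fst a, \<not> snd a)" "dstop G b = dstop G a \<Longrightarrow> b = a"
proof -
  have src: "src G e = dstop G a \<Longrightarrow> e \<in> edges G \<Longrightarrow> e = fst a \<and> \<not> snd a"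
    and tgt: "tgt G e = dstop G a \<Longrightarrow> e \<in> edges G \<Longrightarrow> e = fst a \<and> snd a" for e
    using assms(1) unfolding pendant_edge_def by (auto split: if_splits)
  show "dstart G b = dstop G a \<Longrightarrow> b = (fst a, \<not> snd a)"
    using src[of "fst b"] tgt[of "fst b"] assms(2)
    by (cases b; cases "snd b") (auto simp: dstart_def)
  show "dstop G b = dstop G a \<Longrightarrow> b = a"
    using src[of "fst b"] tgt[of "fst b"] assms(2)
    by (cases a; cases b; cases "snd b") (auto simp: dstop_def)
qed

text \<open>
  A simple walk cannot pass through the leaf, as it would have to return along the same edge.
\<close>

lemma simple_walk_pendant_cases:
  assumes a: "pendant_edge G a" and p: "simple_walk G v p w"
  obtains (last) p1 where "p = p1 @ [a]" "fst a \<notin> fst ` set p1"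
    | (first) p2 where "p = (fst a, \<not> snd a) # p2" "fst a \<notin> fst ` set p2"
    | (avoid) "fst a \<notin> fst ` set p"
proof (cases "fst a \<in> fst ` set p")
  case True
  let ?r = "(fst a, \<not> snd a)"
  have wk: "walk G v p w" and dist: "distinct (map fst p)"
    using p simple_walk_distinct_edges[OF p] by (auto simp: simple_walk_def)
  obtain b where b: "b \<in> set p" "fst b = fst a" using True by (metis imageE)
  then obtain p1 p2 where p12: "p = p1 @ b # p2" by (meson split_list)
  have new: "fst a \<notin> fst ` set p1" "fst a \<notin> fst ` set p2" using dist b(2) p12 by auto
  obtain x where x: "walk G v p1 x" "walk G x (b # p2) w" using wk p12 by (auto simp: walk_append)
  have "b = a \<or> b = ?r" using b(2) by (cases a; cases b; cases "snd a"; cases "snd b") auto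
  then show thesis
  proof
    assume ba: "b = a"
    have "p2 = []"
    proof (cases p2)
      case (Cons c p2')
      then have "fst c \<in> edges G" "dstart G c = dstop G a" using x(2) ba by auto
      then have "c = ?r" using pendant_edge_at_leaf(1)[OF a] by blast
      then show ?thesis using new(2) Cons by auto
    qed
    then show thesis using last[of p1] p12 ba new by simp
  next
    assume br: "b = ?r"
    have "p1 = []"
    proof (cases p1 rule: rev_exhaust)
      case (snoc p1' c)
      then obtain y where "walk G y [c] x" using x(1) by (auto simp: walk_append)
      then have "fst c \<in> edges G" "dstop G c = x" by auto
      moreover have "x = dstop G a" using x(2) br by (auto simp: dstart_def dstop_def split: if_splits)
      ultimately have "c = a" using pendant_edge_at_leaf(2)[OF a] by blast
      then show ?thesis using new(1) snoc by auto
    qed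
    then show thesis using first[of p2] p12 br new by simp
  qed
qed (rule avoid)

section \<open>Potentials on a pendant edge\<close>

lemma walk_length_nonneg:
  "(\<And>a. a \<in> set p \<Longrightarrow> 0 \<le> elen G (fst a)) \<Longrightarrow> 0 \<le> walk_length G p"
  by (auto simp: walk_length_def intro!: sum_list_nonneg)

lemma walk_point_edge:
  "p \<noteq> [] \<Longrightarrow> t \<le> walk_length G p \<Longrightarrow> fst (walk_point G p t) \<in> fst ` set p"
proof (induction p arbitrary: t)
  case (Cons a p)
  show ?case
  proof (cases "t \<le> elen G (fst a)")
    case False
    then have "p \<noteq> []" "t - elen G (fst a) \<le> walk_length G p"
      using Cons.prems by (auto simp: walk_length_def)
    from Cons.IH[OF this] False show ?thesis by (simp add: Let_def)
  qed (simp add: Let_def)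
qed simp

text \<open>
  At a vertex between two edges \<open>walk_point\<close> takes the end of the earlier edge; this is why the
  boundary case \<open>t = walk_length G p\<close> belongs to \<open>p\<close>, unless \<open>p\<close> is empty.
\<close>

lemma walk_point_snoc:
  assumes "\<And>b. b \<in> set p \<Longrightarrow> 0 \<le> elen G (fst b)" "t \<le> walk_length G (p @ [a])"
  shows "walk_point G (p @ [a]) t =
    (if p \<noteq> [] \<and> t \<le> walk_length G p then walk_point G p t
     else (fst a, if snd a then t - walk_length G p else elen G (fst a) - (t - walk_length G p)))"
  using assms
proof (induction p arbitrary: t)
  case Nil
  then show ?case by (simp add: walk_length_def)
next
  case (Cons b p)
  have nn: "0 \<le> walk_length G p" using Cons.prems(1) by (intro walk_length_nonneg) simp
  show ?case
  proof (cases "t \<le> elen G (fst b)")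
    case True
    then show ?thesis using nn by (simp add: Let_def walk_length_def)
  next
    case False
    have "t - elen G (fst b) \<le> walk_length G (p @ [a])" using Cons.prems(2) by (simp add: walk_length_def)
    from Cons.IH[OF _ this] Cons.prems(1) False show ?thesis
      by (cases "p = []") (auto simp: Let_def walk_length_def algebra_simps)
  qed
qed

text \<open>The argument of \<open>Q\<close> is the distance from the inner vertex of the pendant edge.\<close>

definition pendant_function ::
  "('v, 'e) metric_graph \<Rightarrow> 'e \<times> bool \<Rightarrow> (real \<Rightarrow> real) \<Rightarrow> 'e \<times> real \<Rightarrow> real" where
  "pendant_function G a Q p =
     (if fst p = fst a then Q (if snd a then snd p else elen G (fst a) - snd p) else 0)"

lemma convex_on_transfer:
  assumes "convex_on S f" "\<And>x. x \<in> S \<Longrightarrow> g x = f x"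
  shows "convex_on S g"
  using assms by (simp add: convex_on_def convex_def)

lemma convex_on_mono_compose:
  fixes Q :: "real \<Rightarrow> real" and h :: "real \<Rightarrow> real"
  assumes Q: "convex_on B Q" "mono_on B Q" and h: "convex_on A h" "h ` A \<subseteq> B"
  shows "convex_on A (\<lambda>t. Q (h t))"
proof -
  have cA: "convex A" and cB: "convex B" using h(1) Q(1) by (auto simp: convex_on_def)
  show ?thesis
    unfolding convex_on_def
  proof (intro conjI ballI allI impI cA)
    fix x y u v :: real assume xy: "x \<in> A" "y \<in> A" and uv: "0 \<le> u" "0 \<le> v" "u + v = 1"
    have hB: "h x \<in> B" "h y \<in> B" using xy h(2) by auto
    have mem: "u *\<^sub>R x + v *\<^sub>R y \<in> A" "u *\<^sub>R h x + v *\<^sub>R h y \<in> B"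
      using cA cB xy hB uv by (auto simp: convex_def)
    have "h (u *\<^sub>R x + v *\<^sub>R y) \<le> u *\<^sub>R h x + v *\<^sub>R h y"
      using h(1) xy uv by (simp add: convex_on_def)
    then have "Q (h (u *\<^sub>R x + v *\<^sub>R y)) \<le> Q (u *\<^sub>R h x + v *\<^sub>R h y)"
      using Q(2) mem h(2) by (auto simp: mono_on_def)
    also have "\<dots> \<le> u * Q (h x) + v * Q (h y)"
      using Q(1) hB uv by (simp add: convex_on_def)
    finally show "Q (h (u *\<^sub>R x + v *\<^sub>R y)) \<le> u * Q (h x) + v * Q (h y)" .
  qed
qed

lemma convex_on_max_0_affine:
  fixes S :: "real set"
  assumes "convex S"
  shows "convex_on S (\<lambda>t. max 0 (c * t + d))"
  unfolding convex_on_def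
proof (intro conjI ballI allI impI assms)
  fix x y u v :: real assume uv: "0 \<le> u" "0 \<le> v" "u + v = 1"
  have "u * (c * x + d) \<le> u * max 0 (c * x + d)" "v * (c * y + d) \<le> v * max 0 (c * y + d)"
    "0 \<le> u * max 0 (c * x + d)" "0 \<le> v * max 0 (c * y + d)"
    using uv by (auto intro!: mult_left_mono)
  moreover have "c * (u *\<^sub>R x + v *\<^sub>R y) + d = u * (c * x + d) + v * (c * y + d)"
  proof -
    have "d = (u + v) * d" using uv by simp
    then show ?thesis by (simp add: algebra_simps)
  qed
  ultimately show "max 0 (c * (u *\<^sub>R x + v *\<^sub>R y) + d) \<le> u * max 0 (c * x + d) + v * max 0 (c * y + d)"
    by linarith
qed

text \<open>
  Along a walk that ends (or starts) with the pendant edge, the function is \<open>Q\<close> composed with the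
  positive part of an affine function of the arc length, since \<open>Q 0 = 0\<close>. This is convex because
  \<open>Q\<close> is convex and nondecreasing.
\<close>

lemma pendant_function_convex_on_walk:
  assumes G: "\<And>e. e \<in> edges G \<Longrightarrow> 0 < elen G e" and a: "pendant_edge G a"
    and Q: "Q 0 = 0" "convex_on {0..elen G (fst a)} Q" "mono_on {0..elen G (fst a)} Q"
    and p: "simple_walk G v p w" "p \<noteq> []"
  shows "convex_on {0..walk_length G p} (\<lambda>t. pendant_function G a Q (walk_point G p t))"
proof -
  let ?L = "elen G (fst a)" and ?q = "pendant_function G a Q"
  have pos: "0 \<le> elen G (fst b)" if "b \<in> set p" for b
  proof -
    have "walk G v p w" using p(1) by (simp add: simple_walk_def)
    from walk_dstop_in_vertices[OF this that] G show ?thesis by (simp add: less_imp_le)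
  qed
  have L: "0 < ?L" using G a by (simp add: pendant_edge_def)
  have off: "?q (walk_point G r t) = 0" if "fst a \<notin> fst ` set r" "r \<noteq> []" "t \<le> walk_length G r" for r t
  proof -
    have "fst (walk_point G r t) \<noteq> fst a" using walk_point_edge[OF that(2,3)] that(1) by metis
    then show ?thesis by (simp add: pendant_function_def)
  qed
  show ?thesis
    using a p(1)
  proof (cases rule: simple_walk_pendant_cases)
    case (last p1)
    let ?W = "walk_length G p1"
    have len: "walk_length G p = ?W + ?L" using last by (simp add: walk_length_def)
    have W: "0 \<le> ?W" using pos last by (intro walk_length_nonneg) auto
    have "convex_on {0..walk_length G p} (\<lambda>t. Q (max 0 (1 * t + - ?W)))"
      by (rule convex_on_mono_compose[OF Q(2,3) convex_on_max_0_affine]) (use len L in auto)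
    moreover have "?q (walk_point G p t) = Q (max 0 (1 * t + - ?W))" if t: "t \<in> {0..walk_length G p}" for t
    proof (cases "p1 \<noteq> [] \<and> t \<le> ?W")
      case True
      have "walk_point G p t = walk_point G p1 t"
        using walk_point_snoc[of p1 G t a] pos t last True by auto
      then show ?thesis using off[OF last(2)] True Q(1) by simp
    next
      case False
      then have "walk_point G p t = (fst a, if snd a then t - ?W else ?L - (t - ?W))"
        using walk_point_snoc[of p1 G t a] pos t last by auto
      moreover have "?W \<le> t" using False t by (auto simp: walk_length_def)
      ultimately show ?thesis by (simp add: pendant_function_def)
    qed
    ultimately show ?thesis by (rule convex_on_transfer)
  next
    case (first p2)
    have len: "walk_length G p = ?L + walk_length G p2" using first by (simp add: walk_length_def)
    have "convex_on {0..walk_length G p} (\<lambda>t. Q (max 0 (- 1 * t + ?L)))"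
      by (rule convex_on_mono_compose[OF Q(2,3) convex_on_max_0_affine]) (use len L in auto)
    moreover have "?q (walk_point G p t) = Q (max 0 (- 1 * t + ?L))" if t: "t \<in> {0..walk_length G p}" for t
    proof (cases "t \<le> ?L")
      case True
      then show ?thesis using first by (auto simp: pendant_function_def Let_def)
    next
      case False
      then have "walk_point G p t = walk_point G p2 (t - ?L)" "t - ?L \<le> walk_length G p2" "p2 \<noteq> []"
        using first t len by (auto simp: Let_def walk_length_def)
      then show ?thesis using off[OF first(2)] False Q(1) by simp
    qed
    ultimately show ?thesis by (rule convex_on_transfer)
  next
    case avoid
    have "convex_on {0..walk_length G p} (\<lambda>t. 0 :: real)" by (simp add: convex_on_def)
    moreover have "?q (walk_point G p t) = 0" if "t \<in> {0..walk_length G p}" for t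
      using off[OF avoid p(2)] that by simp
    ultimately show ?thesis by (rule convex_on_transfer)
  qed
qed

section \<open>Homogeneous linear systems\<close>

text \<open>
  More unknowns than equations. This is used for three purposes: to bound the dimension of an
  eigenspace, to find an eigenfunction that vanishes at a given point, and to solve the vertex
  conditions at all vertices but one.
\<close>

lemma homogeneous_system_nontrivial:
  fixes a :: "'i \<Rightarrow> 'j \<Rightarrow> real"
  assumes "finite I" "finite J" "card I < card J"
  shows "\<exists>x. (\<exists>j\<in>J. x j \<noteq> 0) \<and> (\<forall>i\<in>I. (\<Sum>j\<in>J. a i j * x j) = 0)"
  using assms
proof (induction I arbitrary: a J rule: finite_induct)
  case empty
  then obtain j where "j \<in> J" by (auto simp: card_gt_0_iff)
  then show ?case by (intro exI[of _ "\<lambda>_. 1"]) auto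
next
  case (insert i0 I)
  show ?case
  proof (cases "\<forall>j\<in>J. a i0 j = 0")
    case True
    have "card I < card J" using insert.prems insert.hyps by simp
    from insert.IH[OF insert.prems(1) this, of a] True show ?thesis by (auto intro!: sum.neutral)
  next
    case False
    then obtain j0 where j0: "j0 \<in> J" "a i0 j0 \<noteq> 0" by blast
    let ?J = "J - {j0}"
    \<comment> \<open>Gaussian elimination of the unknown \<open>j0\<close> by means of the equation \<open>i0\<close>.\<close>
    define b where "b i j = a i j - a i j0 * a i0 j / a i0 j0" for i j
    have "card I < card ?J" using insert.prems insert.hyps j0 by simp
    then obtain x where x: "\<exists>j\<in>?J. x j \<noteq> 0" "\<forall>i\<in>I. (\<Sum>j\<in>?J. b i j * x j) = 0"
      using insert.IH[of ?J b] insert.prems(1) by auto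
    define x' where "x' j = (if j = j0 then - (\<Sum>j\<in>?J. a i0 j * x j) / a i0 j0 else x j)" for j
    have split: "(\<Sum>j\<in>J. a i j * x' j) = a i j0 * x' j0 + (\<Sum>j\<in>?J. a i j * x j)" for i
    proof -
      have "(\<Sum>j\<in>?J. a i j * x' j) = (\<Sum>j\<in>?J. a i j * x j)"
        by (rule sum.cong) (auto simp: x'_def)
      then show ?thesis using insert.prems(1) j0(1) by (simp add: sum.remove)
    qed
    have "(\<Sum>j\<in>?J. b i j * x j) =
        (\<Sum>j\<in>?J. a i j * x j) - a i j0 / a i0 j0 * (\<Sum>j\<in>?J. a i0 j * x j)" for i
      by (simp add: b_def algebra_simps sum_subtractf sum_distrib_left)
    then have elim: "(\<Sum>j\<in>?J. a i j * x j) = a i j0 / a i0 j0 * (\<Sum>j\<in>?J. a i0 j * x j)"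
      if "i \<in> insert i0 I" for i
      using that x(2) j0(2) by (cases "i = i0") auto
    have x'j0: "x' j0 = - (\<Sum>j\<in>?J. a i0 j * x j) / a i0 j0" by (simp add: x'_def)
    have "(\<Sum>j\<in>J. a i j * x' j) = 0" if "i \<in> insert i0 I" for i
      unfolding split elim[OF that] by (simp add: x'j0)
    moreover have "\<exists>j\<in>J. x' j \<noteq> 0" using x(1) by (auto simp: x'_def)
    ultimately show ?thesis by blast
  qed
qed

section \<open>Second-order linear equations on an interval\<close>

text \<open>The differential equation is \<open>f'' = V f\<close> in the classical sense, with one-sided derivatives at the ends.\<close>

definition ode_solution :: "real \<Rightarrow> (real \<Rightarrow> real) \<Rightarrow> (real \<Rightarrow> real) \<Rightarrow> (real \<Rightarrow> real) \<Rightarrow> bool" where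
  "ode_solution L V f f1 \<longleftrightarrow>
     (\<forall>x\<in>{0..L}. (f has_real_derivative f1 x) (at x within {0..L}) \<and>
                 (f1 has_real_derivative V x * f x) (at x within {0..L}))"

lemma ode_solution_continuous:
  assumes "ode_solution L V f f1"
  shows "continuous_on {0..L} f" "continuous_on {0..L} f1"
  using assms unfolding ode_solution_def continuous_on_eq_continuous_within
  by (meson DERIV_continuous)+

lemma ode_solution_add:
  assumes "ode_solution L V f f1" "ode_solution L V g g1"
  shows "ode_solution L V (\<lambda>x. f x + g x) (\<lambda>x. f1 x + g1 x)"
  using assms unfolding ode_solution_def
  by (auto intro!: derivative_eq_intros simp: algebra_simps)

lemma ode_solution_scale:
  assumes "ode_solution L V f f1"
  shows "ode_solution L V (\<lambda>x. c * f x) (\<lambda>x. c * f1 x)"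
  using assms unfolding ode_solution_def
  by (auto intro!: derivative_eq_intros simp: algebra_simps)

lemma ode_solution_reflect:
  assumes "ode_solution L V f f1"
  shows "ode_solution L (\<lambda>x. V (L - x)) (\<lambda>x. f (L - x)) (\<lambda>x. - f1 (L - x))"
  unfolding ode_solution_def
proof (intro ballI conjI)
  fix x assume x: "x \<in> {0..L}"
  have im: "(\<lambda>x. L - x) ` {0..L} \<subseteq> {0..L}" by auto
  have d: "((\<lambda>x. L - x) has_real_derivative -1) (at x within {0..L})"
    by (auto intro!: derivative_eq_intros)
  have "L - x \<in> {0..L}" using x by auto
  with assms have
    "(f has_real_derivative f1 (L - x)) (at (L - x) within {0..L})"
    "(f1 has_real_derivative V (L - x) * f (L - x)) (at (L - x) within {0..L})"
    by (auto simp: ode_solution_def)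
  then have
    "(f has_real_derivative f1 (L - x)) (at (L - x) within (\<lambda>x. L - x) ` {0..L})"
    "(f1 has_real_derivative V (L - x) * f (L - x)) (at (L - x) within (\<lambda>x. L - x) ` {0..L})"
    using im by (meson DERIV_subset)+
  from DERIV_image_chain[OF this(1) d] DERIV_image_chain[OF this(2) d]
  show "((\<lambda>x. f (L - x)) has_real_derivative - f1 (L - x)) (at x within {0..L})"
    "((\<lambda>x. - f1 (L - x)) has_real_derivative V (L - x) * f (L - x)) (at x within {0..L})"
    by (auto simp: o_def dest: DERIV_minus)
qed

text \<open>Gronwall's argument: \<open>(f\<^sup>2 + f1\<^sup>2) exp (- C x)\<close> is nonincreasing if \<open>1 + \<bar>V\<bar> \<le> C\<close>.\<close>

lemma ode_solution_unique:
  assumes sol: "ode_solution L V f f1" and V: "continuous_on {0..L} V"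
    and "f 0 = 0" "f1 0 = 0" "x \<in> {0..L}"
  shows "f x = 0"
proof -
  have "bounded (V ` {0..L})"
    by (rule compact_imp_bounded[OF compact_continuous_image[OF V]]) simp
  then obtain B where "\<forall>y\<in>V ` {0..L}. norm y \<le> B" unfolding bounded_iff by blast
  then have B: "\<bar>V x\<bar> \<le> B" if "x \<in> {0..L}" for x using that by simp
  define C where "C = 1 + B"
  define E where "E x = ((f x)\<^sup>2 + (f1 x)\<^sup>2) * exp (- C * x)" for x
  define E1 where "E1 x = (2 * f x * f1 x * (1 + V x) - C * ((f x)\<^sup>2 + (f1 x)\<^sup>2)) * exp (- C * x)" for x
  have dE: "(E has_real_derivative E1 t) (at t within {0..L})" if "t \<in> {0..L}" for t
    using that sol unfolding ode_solution_def E_def E1_def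
    by (auto intro!: derivative_eq_intros simp: algebra_simps power2_eq_square)
  have neg: "E1 t \<le> 0" if "t \<in> {0..L}" for t
  proof -
    have "\<bar>2 * f t * f1 t\<bar> \<le> (f t)\<^sup>2 + (f1 t)\<^sup>2"
      using sum_squares_bound[of "f t" "f1 t"] sum_squares_bound[of "- f t" "f1 t"] by (simp add: abs_le_iff)
    moreover have "\<bar>1 + V t\<bar> \<le> C" using B[OF that] by (simp add: C_def)
    ultimately have "\<bar>2 * f t * f1 t\<bar> * \<bar>1 + V t\<bar> \<le> ((f t)\<^sup>2 + (f1 t)\<^sup>2) * C"
      by (intro mult_mono) auto
    then have "2 * f t * f1 t * (1 + V t) \<le> C * ((f t)\<^sup>2 + (f1 t)\<^sup>2)"
      by (metis abs_le_D1 abs_mult mult.commute)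
    then show ?thesis by (simp add: E1_def mult_le_0_iff)
  qed
  have "E x \<le> E 0"
  proof (rule DERIV_nonpos_imp_decreasing_open[where f = E])
    have "continuous_on {0..L} E"
      unfolding continuous_on_eq_continuous_within using dE by (blast intro: DERIV_continuous)
    then show "continuous_on {0..x} E" by (rule continuous_on_subset) (use assms(5) in auto)
    fix t assume t: "0 < t" "t < x"
    then have "(E has_real_derivative E1 t) (at t)"
      using dE[of t] assms(5) by (simp add: at_within_Icc_at)
    with neg[of t] t assms(5) show "\<exists>y. (E has_real_derivative y) (at t) \<and> y \<le> 0" by auto
  qed (use assms(5) in auto)
  then have "((f x)\<^sup>2 + (f1 x)\<^sup>2) * exp (- C * x) \<le> 0" using assms(3,4) by (simp add: E_def)
  then have "(f x)\<^sup>2 + (f1 x)\<^sup>2 \<le> 0" by (simp add: mult_le_0_iff)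
  then show ?thesis by (simp add: sum_power2_le_zero_iff)
qed

lemma ode_solution_unique_end:
  assumes sol: "ode_solution L V f f1" and V: "continuous_on {0..L} V"
    and "f L = 0" "f1 L = 0" "x \<in> {0..L}"
  shows "f x = 0"
proof -
  have "continuous_on {0..L} (\<lambda>x. V (L - x))"
    by (rule continuous_on_compose2[OF V]) (auto intro!: continuous_intros)
  from ode_solution_unique[OF ode_solution_reflect[OF sol] this, of "L - x"] assms(3-5)
  show ?thesis by auto
qed

text \<open>
  For a continuous \<open>V\<close> the weak second derivative agrees almost everywhere with the continuous
  function \<open>V f\<close>, so the fundamental theorem of calculus makes \<open>f1\<close> continuously differentiable.
\<close>

lemma H2_on_iff_ode_solution:
  assumes L: "0 < L" and V: "continuous_on {0..L} V"
  shows "(\<exists>f2. H2_on L f f1 f2 \<and> (AE x in lebesgue_on {0..L}. f2 x = V x * f x)) \<longleftrightarrow>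
    ode_solution L V f f1"
proof
  assume "\<exists>f2. H2_on L f f1 f2 \<and> (AE x in lebesgue_on {0..L}. f2 x = V x * f x)"
  then obtain f2 where h: "H2_on L f f1 f2" and ae: "AE x in lebesgue_on {0..L}. f2 x = V x * f x"
    by blast
  have d: "(f has_real_derivative f1 x) (at x within {0..L})" if "x \<in> {0..L}" for x
    using h that unfolding H2_on_def by blast
  then have "continuous_on {0..L} f"
    unfolding continuous_on_eq_continuous_within by (meson DERIV_continuous)
  then have cont: "continuous_on {0..L} (\<lambda>x. V x * f x)" using V by (intro continuous_intros)
  from ae have "AE x in lebesgue. x \<in> {0..L} \<longrightarrow> f2 x = V x * f x"
    by (subst (asm) AE_restrict_space_iff) auto
  then obtain N where N: "N \<in> null_sets lebesgue" "{x \<in> space lebesgue. \<not> (x \<in> {0..L} \<longrightarrow> f2 x = V x * f x)} \<subseteq> N"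
    unfolding eventually_ae_filter by blast
  then have "negligible N" by (simp add: negligible_iff_null_sets)
  then have eq: "integral {0..x} f2 = integral {0..x} (\<lambda>x. V x * f x)" if "x \<in> {0..L}" for x
    using N(2) that by (intro integral_spike[of N]) auto
  show "ode_solution L V f f1"
    unfolding ode_solution_def
  proof (intro ballI conjI)
    fix x assume x: "x \<in> {0..L}"
    have "((\<lambda>x. f1 0 + integral {0..x} (\<lambda>x. V x * f x)) has_real_derivative V x * f x) (at x within {0..L})"
      by (rule DERIV_add[OF DERIV_const, simplified]) (rule integral_has_real_derivative[OF cont x])
    then show "(f1 has_real_derivative V x * f x) (at x within {0..L})"
    proof (rule has_field_derivative_transform_within[where d = 1])
      fix y assume "y \<in> {0..L}"
      then show "f1 0 + integral {0..y} (\<lambda>x. V x * f x) = f1 y"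
        using h eq[of y] unfolding H2_on_def by metis
    qed (use x in auto)
  qed (rule d)
next
  assume s: "ode_solution L V f f1"
  have cont: "continuous_on {0..L} (\<lambda>x. V x * f x)"
    using V ode_solution_continuous[OF s] by (intro continuous_intros)
  have "f1 x = f1 0 + integral {0..x} (\<lambda>x. V x * f x)" if x: "x \<in> {0..L}" for x
  proof -
    have "((\<lambda>x. V x * f x) has_integral f1 x - f1 0) {0..x}"
    proof (rule fundamental_theorem_of_calculus)
      fix t assume t: "t \<in> {0..x}"
      then have "(f1 has_real_derivative V t * f t) (at t within {0..L})"
        using s x by (auto simp: ode_solution_def)
      then have "(f1 has_real_derivative V t * f t) (at t within {0..x})"
        by (rule DERIV_subset) (use x in auto)
      then show "(f1 has_vector_derivative V t * f t) (at t within {0..x})"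
        by (simp add: has_real_derivative_iff_has_vector_derivative)
    qed (use x in auto)
    then show ?thesis by (simp add: integral_unique)
  qed
  moreover have "square_integrable {0..L} (\<lambda>x. V x * f x)"
    unfolding square_integrable_def
    using cont by (auto intro!: continuous_imp_measurable_on_sets_lebesgue continuous_imp_integrable_real continuous_intros)
  ultimately have "H2_on L f f1 (\<lambda>x. V x * f x)"
    using s unfolding H2_on_def ode_solution_def by blast
  then show "\<exists>f2. H2_on L f f1 f2 \<and> (AE x in lebesgue_on {0..L}. f2 x = V x * f x)" by auto
qed

section \<open>Eigenspaces\<close>

text \<open>
  This is the classical form of the eigenvalue equation, which carries the derivative \<open>u1\<close> along.
  Nothing is required of \<open>u\<close> off the graph, and \<open>u = 0\<close> is included, so for fixed \<open>\<mu>\<close>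
  the eigenfunctions form a vector space.
\<close>

definition eigenfunction ::
  "('v, 'e) metric_graph \<Rightarrow> ('e \<times> real \<Rightarrow> real) \<Rightarrow> real \<Rightarrow> ('e \<times> real \<Rightarrow> real) \<Rightarrow> ('e \<times> real \<Rightarrow> real) \<Rightarrow> bool"
  where "eigenfunction G q \<mu> u u1 \<longleftrightarrow> glued G u \<and>
    (\<forall>e\<in>edges G. ode_solution (elen G e) (\<lambda>x. q (e, x) - \<mu>) (\<lambda>x. u (e, x)) (\<lambda>x. u1 (e, x))) \<and>
    (\<forall>v\<in>vertices G. normal_derivative_sum G u1 v = 0)"

definition continuous_potential :: "('v, 'e) metric_graph \<Rightarrow> ('e \<times> real \<Rightarrow> real) \<Rightarrow> bool" where
  "continuous_potential G q \<longleftrightarrow> (\<forall>e\<in>edges G. continuous_on {0..elen G e} (\<lambda>x. q (e, x)))"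

lemma eigenspace_iff_eigenfunction:
  assumes G: "compact_metric_graph G" and q: "continuous_potential G q"
  shows "u \<in> eigenspace G q \<mu> \<longleftrightarrow>
    (\<forall>p. p \<notin> graph_points G \<longrightarrow> u p = 0) \<and> (\<exists>u1. eigenfunction G q \<mu> u u1)"
proof -
  have L: "0 < elen G e" and V: "continuous_on {0..elen G e} (\<lambda>x. q (e, x) - \<mu>)"
    if "e \<in> edges G" for e
    using that G q by (auto simp: compact_metric_graph_def continuous_potential_def intro!: continuous_intros)
  have ae: "(AE x in M. \<mu> * u (e, x) = - u2 (e, x) + q (e, x) * u (e, x)) \<longleftrightarrow>
      (AE x in M. u2 (e, x) = (q (e, x) - \<mu>) * u (e, x))" for M :: "real measure" and u2 e
    by (rule AE_cong) (auto simp: algebra_simps)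
  have iff: "(\<exists>f2. H2_on (elen G e) (\<lambda>x. u (e, x)) (\<lambda>x. u1 (e, x)) f2 \<and>
        (AE x in lebesgue_on {0..elen G e}. f2 x = (q (e, x) - \<mu>) * u (e, x))) \<longleftrightarrow>
      ode_solution (elen G e) (\<lambda>x. q (e, x) - \<mu>) (\<lambda>x. u (e, x)) (\<lambda>x. u1 (e, x))"
    if "e \<in> edges G" for e u1
    by (rule H2_on_iff_ode_solution[OF L V]) fact+
  have ex: "(\<exists>u2. \<forall>e\<in>edges G. H2_on (elen G e) (\<lambda>x. u (e, x)) (\<lambda>x. u1 (e, x)) (\<lambda>x. u2 (e, x)) \<and>
        (AE x in lebesgue_on {0..elen G e}. u2 (e, x) = (q (e, x) - \<mu>) * u (e, x))) \<longleftrightarrow>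
      (\<forall>e\<in>edges G. ode_solution (elen G e) (\<lambda>x. q (e, x) - \<mu>) (\<lambda>x. u (e, x)) (\<lambda>x. u1 (e, x)))"
    (is "?l \<longleftrightarrow> ?r") for u1
  proof
    assume ?l
    then show ?r using iff by blast
  next
    assume ?r
    then have "\<forall>e\<in>edges G. \<exists>f2. H2_on (elen G e) (\<lambda>x. u (e, x)) (\<lambda>x. u1 (e, x)) f2 \<and>
        (AE x in lebesgue_on {0..elen G e}. f2 x = (q (e, x) - \<mu>) * u (e, x))"
      using iff by blast
    then obtain F where "\<forall>e\<in>edges G. H2_on (elen G e) (\<lambda>x. u (e, x)) (\<lambda>x. u1 (e, x)) (F e) \<and>
        (AE x in lebesgue_on {0..elen G e}. F e x = (q (e, x) - \<mu>) * u (e, x))"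
      by (rule bchoice[THEN exE])
    then show ?l by (intro exI[of _ "\<lambda>(e, x). F e x"]) simp
  qed
  have sq: "square_integrable {0..elen G e} (\<lambda>x. \<mu> * u (e, x))"
    if "eigenfunction G q \<mu> u u1" "e \<in> edges G" for u1 e
  proof -
    have "continuous_on {0..elen G e} (\<lambda>x. u (e, x))"
      using that ode_solution_continuous(1) by (fastforce simp: eigenfunction_def)
    then show ?thesis
      unfolding square_integrable_def
      by (auto intro!: continuous_imp_measurable_on_sets_lebesgue continuous_imp_integrable_real
          continuous_intros)
  qed
  have "u \<in> eigenspace G q \<mu> \<longleftrightarrow> (\<forall>p. p \<notin> graph_points G \<longrightarrow> u p = 0) \<and> glued G u \<and>
      (\<forall>e\<in>edges G. square_integrable {0..elen G e} (\<lambda>x. \<mu> * u (e, x))) \<and>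
      (\<exists>u1. (\<exists>u2. \<forall>e\<in>edges G. H2_on (elen G e) (\<lambda>x. u (e, x)) (\<lambda>x. u1 (e, x)) (\<lambda>x. u2 (e, x)) \<and>
        (AE x in lebesgue_on {0..elen G e}. u2 (e, x) = (q (e, x) - \<mu>) * u (e, x))) \<and>
        (\<forall>v\<in>vertices G. normal_derivative_sum G u1 v = 0))"
    unfolding eigenspace_def schroedinger_def mem_Collect_eq prod.case ae by blast
  then show ?thesis
    unfolding ex using sq unfolding eigenfunction_def by blast
qed

lemma eigenspace_vanishes_outside:
  "u \<in> eigenspace G q \<mu> \<Longrightarrow> p \<notin> graph_points G \<Longrightarrow> u p = 0"
  unfolding eigenspace_def schroedinger_def by blast

lemma eigenfunction_add:
  assumes "eigenfunction G q \<mu> u u1" "eigenfunction G q \<mu> w w1"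
  shows "eigenfunction G q \<mu> (\<lambda>p. u p + w p) (\<lambda>p. u1 p + w1 p)"
proof -
  obtain f g where "\<forall>e\<in>edges G. u (e, 0) = f (src G e) \<and> u (e, elen G e) = f (tgt G e)"
    "\<forall>e\<in>edges G. w (e, 0) = g (src G e) \<and> w (e, elen G e) = g (tgt G e)"
    using assms unfolding eigenfunction_def glued_def by blast
  then have "glued G (\<lambda>p. u p + w p)"
    unfolding glued_def by (intro exI[of _ "\<lambda>v. f v + g v"]) simp
  moreover have "normal_derivative_sum G (\<lambda>p. u1 p + w1 p) v =
      normal_derivative_sum G u1 v + normal_derivative_sum G w1 v" for v
    by (simp add: normal_derivative_sum_def sum.distrib sum_subtractf sum_negf)
  ultimately show ?thesis
    using assms by (auto simp: eigenfunction_def intro: ode_solution_add)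
qed

lemma eigenfunction_scale:
  assumes "eigenfunction G q \<mu> u u1"
  shows "eigenfunction G q \<mu> (\<lambda>p. c * u p) (\<lambda>p. c * u1 p)"
proof -
  obtain f where "\<forall>e\<in>edges G. u (e, 0) = f (src G e) \<and> u (e, elen G e) = f (tgt G e)"
    using assms unfolding eigenfunction_def glued_def by blast
  then have "glued G (\<lambda>p. c * u p)"
    unfolding glued_def by (intro exI[of _ "\<lambda>v. c * f v"]) simp
  moreover have "normal_derivative_sum G (\<lambda>p. c * u1 p) v = c * normal_derivative_sum G u1 v" for v
    by (simp add: normal_derivative_sum_def sum_distrib_left algebra_simps sum_negf)
  ultimately show ?thesis
    using assms by (auto simp: eigenfunction_def intro: ode_solution_scale)
qed

lemma eigenfunction_zero: "eigenfunction G q \<mu> (\<lambda>_. 0) (\<lambda>_. 0)"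
  by (auto simp: eigenfunction_def glued_def ode_solution_def normal_derivative_sum_def)

lemma eigenfunction_sum:
  assumes "finite B" "\<And>b. b \<in> B \<Longrightarrow> eigenfunction G q \<mu> b (D b)"
  shows "eigenfunction G q \<mu> (\<lambda>p. \<Sum>b\<in>B. x b * b p) (\<lambda>p. \<Sum>b\<in>B. x b * D b p)"
  using assms
proof (induction B rule: finite_induct)
  case empty
  show ?case using eigenfunction_zero[of G q \<mu>] by simp
next
  case (insert b B)
  from eigenfunction_add[OF eigenfunction_scale[of G q \<mu> b "D b" "x b"] insert.IH] insert
  show ?case by simp
qed

lemma sum_fun_apply: "(\<Sum>b\<in>B. F b) p = (\<Sum>b\<in>B. F b p)"
  by (induction B rule: infinite_finite_induct) (auto simp: zero_fun_def)

lemma eigenfunction_zero_initial_data: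
  assumes "continuous_potential G q" "eigenfunction G q \<mu> u u1" "(e, x) \<in> graph_points G"
    and "u (e, 0) = 0 \<and> u1 (e, 0) = 0 \<or> u (e, elen G e) = 0 \<and> u1 (e, elen G e) = 0"
  shows "u (e, x) = 0"
proof -
  have e: "e \<in> edges G" "x \<in> {0..elen G e}" using assms(3) by (auto simp: graph_points_def)
  have V: "continuous_on {0..elen G e} (\<lambda>x. q (e, x) - \<mu>)"
    using assms(1) e by (auto simp: continuous_potential_def intro!: continuous_intros)
  have sol: "ode_solution (elen G e) (\<lambda>x. q (e, x) - \<mu>) (\<lambda>x. u (e, x)) (\<lambda>x. u1 (e, x))"
    using assms(2) e by (simp add: eigenfunction_def)
  from assms(4) show ?thesis
    using ode_solution_unique[OF sol V _ _ e(2)] ode_solution_unique_end[OF sol V _ _ e(2)] by blast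
qed

text \<open>
  The values of \<open>u\<close> and \<open>u1\<close> at the start of each edge determine an eigenfunction, so an
  independent family has at most twice as many members as there are edges.
\<close>

lemma independent_in_eigenspace_finite:
  assumes G: "compact_metric_graph G" and q: "continuous_potential G q"
    and B: "B \<subseteq> eigenspace G q \<mu>" "real_fun.independent B"
  shows "finite B"
proof (rule ccontr)
  assume "infinite B"
  then obtain C where C: "C \<subseteq> B" "finite C" "card C = Suc (card (edges G \<times> (UNIV :: bool set)))"
    using infinite_arbitrarily_large by metis
  have fin: "finite (edges G \<times> (UNIV :: bool set))" using G by (simp add: compact_metric_graph_def)
  have "\<exists>D. \<forall>b\<in>C. eigenfunction G q \<mu> b (D b)"
    by (rule bchoice) (use B(1) C(1) eigenspace_iff_eigenfunction[OF G q] in blast)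
  then obtain D where D: "\<And>b. b \<in> C \<Longrightarrow> eigenfunction G q \<mu> b (D b)" by blast
  \<comment> \<open>the equation \<open>(e, True)\<close> asks for value \<open>0\<close> at the start of \<open>e\<close>, the equation \<open>(e, False)\<close> for derivative \<open>0\<close>\<close>
  define a where "a i b = (if snd i then b (fst i, 0) else D b (fst i, 0))" for i :: "'b \<times> bool" and b
  obtain x where x: "\<exists>b\<in>C. x b \<noteq> 0" "\<forall>i\<in>edges G \<times> UNIV. (\<Sum>b\<in>C. a i b * x b) = 0"
    using homogeneous_system_nontrivial[OF fin C(2), of a] C(3) by auto
  let ?w = "\<lambda>p. \<Sum>b\<in>C. x b * b p"
  have w: "eigenfunction G q \<mu> ?w (\<lambda>p. \<Sum>b\<in>C. x b * D b p)"
    by (rule eigenfunction_sum[OF C(2) D])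
  have "?w p = 0" for p
  proof (cases "p \<in> graph_points G")
    case False
    then show ?thesis
      using B(1) C(1) by (intro sum.neutral) (auto dest: eigenspace_vanishes_outside)
  next
    case True
    obtain e t where p: "p = (e, t)" by (cases p)
    with True have "e \<in> edges G" by (simp add: graph_points_def)
    then have "?w (e, 0) = 0" "(\<Sum>b\<in>C. x b * D b (e, 0)) = 0"
      using x(2)[rule_format, of "(e, True)"] x(2)[rule_format, of "(e, False)"]
      by (simp_all add: a_def mult.commute)
    then show ?thesis using eigenfunction_zero_initial_data[OF q w, of e t] True p by blast
  qed
  then have "(\<Sum>b\<in>C. (\<lambda>p. x b * b p)) = 0" by (simp add: fun_eq_iff sum_fun_apply)
  then have "real_fun.dependent C" using x(1) C(2) by (auto simp: real_fun.dependent_finite)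
  then show False using B(2) C(1) real_fun.dependent_mono by blast
qed

text \<open>
  \<open>eigen_mult\<close> is \<open>0\<close> for a space of infinite dimension; finiteness rules out this default value.
\<close>

lemma eigen_mult_basis:
  assumes "compact_metric_graph G" "continuous_potential G q"
  obtains B where "B \<subseteq> eigenspace G q \<mu>" "real_fun.independent B" "finite B"
    "eigenspace G q \<mu> \<subseteq> real_fun.span B" "card B = eigen_mult G q \<mu>"
  using real_fun.basis_exists[of "eigenspace G q \<mu>"] independent_in_eigenspace_finite[OF assms]
  unfolding eigen_mult_def by metis

lemma eigen_mult_pos_iff:
  assumes "compact_metric_graph G" "continuous_potential G q"
  shows "0 < eigen_mult G q \<mu> \<longleftrightarrow> (\<exists>u\<in>eigenspace G q \<mu>. u \<noteq> 0)"
proof -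
  obtain B where B: "B \<subseteq> eigenspace G q \<mu>" "real_fun.independent B" "finite B"
    "eigenspace G q \<mu> \<subseteq> real_fun.span B" "card B = eigen_mult G q \<mu>"
    using eigen_mult_basis[OF assms] by blast
  have "0 \<notin> B" using B(2) real_fun.dependent_zero by blast
  then have "B = {} \<longleftrightarrow> (\<forall>u\<in>eigenspace G q \<mu>. u = 0)"
    using B(1,4) by auto
  then show ?thesis using B(3,5) by (metis card_gt_0_iff)
qed

text \<open>
  Vanishing at \<open>p0\<close> is one linear condition on a space of dimension at least two.
\<close>

lemma eigen_mult_2_vanishing:
  assumes "compact_metric_graph G" "continuous_potential G q" "2 \<le> eigen_mult G q \<mu>"
  obtains u where "u \<in> eigenspace G q \<mu>" "u \<noteq> 0" "u p0 = 0"
proof -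
  obtain B where B: "B \<subseteq> eigenspace G q \<mu>" "real_fun.independent B" "finite B"
    "eigenspace G q \<mu> \<subseteq> real_fun.span B" "card B = eigen_mult G q \<mu>"
    using eigen_mult_basis[OF assms(1,2)] by blast
  have "\<exists>x. (\<exists>b\<in>B. x b \<noteq> 0) \<and> (\<forall>i\<in>{()}. (\<Sum>b\<in>B. b p0 * x b) = 0)"
    by (rule homogeneous_system_nontrivial) (use B(3,5) assms(3) in simp_all)
  then obtain x where x: "\<exists>b\<in>B. x b \<noteq> 0" "(\<Sum>b\<in>B. b p0 * x b) = 0" by blast
  let ?u = "\<lambda>p. \<Sum>b\<in>B. x b * b p"
  have "\<exists>D. \<forall>b\<in>B. eigenfunction G q \<mu> b (D b)"
    by (rule bchoice) (use B(1) eigenspace_iff_eigenfunction[OF assms(1,2)] in blast)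
  then obtain D where "\<And>b. b \<in> B \<Longrightarrow> eigenfunction G q \<mu> b (D b)" by blast
  from eigenfunction_sum[OF B(3) this] have "\<exists>u1. eigenfunction G q \<mu> ?u u1" by blast
  moreover have "?u p = 0" if "p \<notin> graph_points G" for p
    using that B(1) by (intro sum.neutral) (auto dest: eigenspace_vanishes_outside)
  ultimately have "?u \<in> eigenspace G q \<mu>"
    unfolding eigenspace_iff_eigenfunction[OF assms(1,2)] by blast
  moreover have "?u \<noteq> 0"
  proof
    assume "?u = 0"
    then have "(\<Sum>b\<in>B. (\<lambda>p. x b * b p)) = 0" by (simp add: fun_eq_iff sum_fun_apply)
    then show False using x(1) B(2,3) by (auto simp: real_fun.dependent_finite)
  qed
  ultimately show thesis using that x(2) by (simp add: mult.commute)
qed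

section \<open>Picone's identity and the lowest eigenvalues\<close>

text \<open>
  This turns the vertex conditions into boundary terms of integrations by parts on the edges; \<open>g\<close> is
  the common vertex value of the multiplier.
\<close>

lemma sum_vertices_normal_derivative:
  assumes "finite (edges G)"
  shows "(\<Sum>v\<in>vertices G. g v * normal_derivative_sum G u1 v) =
    (\<Sum>e\<in>edges G. g (src G e) * u1 (e, 0) - g (tgt G e) * u1 (e, elen G e))"
proof -
  have "(\<Sum>v\<in>vertices G. g v * (\<Sum>e | e \<in> edges G \<and> h e = v. k e)) = (\<Sum>e\<in>edges G. g (h e) * k e)"
    if "h ` edges G \<subseteq> vertices G" for h k
  proof -
    have "(\<Sum>v\<in>vertices G. g v * (\<Sum>e | e \<in> edges G \<and> h e = v. k e)) =
        (\<Sum>v\<in>vertices G. \<Sum>e | e \<in> edges G \<and> h e = v. g (h e) * k e)"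
      by (auto simp: sum_distrib_left intro!: sum.cong)
    also have "\<dots> = (\<Sum>e\<in>edges G. g (h e) * k e)"
      by (rule sum.group) (use assms that in \<open>auto simp: vertices_def\<close>)
    finally show ?thesis .
  qed
  from this[of "src G" "\<lambda>e. u1 (e, 0)"] this[of "tgt G" "\<lambda>e. - u1 (e, elen G e)"]
  show ?thesis
    by (simp add: normal_derivative_sum_def vertices_def distrib_left right_diff_distrib sum.distrib sum_subtractf sum_negf)
qed

text \<open>
  The boundary terms come from \<open>w w' - (f' / f) w\<^sup>2\<close>, whose derivative is the integrand.
\<close>

lemma picone_identity:
  assumes L: "0 \<le> L"
    and f: "ode_solution L (\<lambda>x. q x - \<nu>) f f1" and pos: "\<And>x. x \<in> {0..L} \<Longrightarrow> 0 < f x"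
    and w: "ode_solution L (\<lambda>x. q x - \<mu>) w w1"
  shows "((\<lambda>x. (w1 x - f1 x / f x * w x)\<^sup>2 + (\<nu> - \<mu>) * (w x)\<^sup>2) has_integral
      (w L * w1 L - f1 L / f L * (w L)\<^sup>2) - (w 0 * w1 0 - f1 0 / f 0 * (w 0)\<^sup>2)) {0..L}"
proof (rule fundamental_theorem_of_calculus[OF L])
  fix x assume x: "x \<in> {0..L}"
  have "f x \<noteq> 0" using pos[OF x] by simp
  moreover have "(f has_real_derivative f1 x) (at x within {0..L})"
    "(f1 has_real_derivative (q x - \<nu>) * f x) (at x within {0..L})"
    "(w has_real_derivative w1 x) (at x within {0..L})"
    "(w1 has_real_derivative (q x - \<mu>) * w x) (at x within {0..L})"
    using f w x by (auto simp: ode_solution_def)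
  ultimately have "((\<lambda>x. w x * w1 x - f1 x / f x * (w x)\<^sup>2) has_real_derivative
      (w1 x - f1 x / f x * w x)\<^sup>2 + (\<nu> - \<mu>) * (w x)\<^sup>2) (at x within {0..L})"
    by (auto intro!: derivative_eq_intros simp: field_simps power2_eq_square)
  then show "((\<lambda>x. w x * w1 x - f1 x / f x * (w x)\<^sup>2) has_vector_derivative
      (w1 x - f1 x / f x * w x)\<^sup>2 + (\<nu> - \<mu>) * (w x)\<^sup>2) (at x within {0..L})"
    by (simp add: has_real_derivative_iff_has_vector_derivative)
qed

text \<open>
  Summed over the edges, the boundary terms of Picone's identity are combinations of the vertex
  conditions of \<open>w\<close> and of \<open>f\<close>, with weights \<open>w\<close> and \<open>w\<^sup>2 / f\<close>, and cancel. So the integrand, which is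
  nonnegative for \<open>\<mu> \<le> \<nu>\<close>, vanishes identically.
\<close>

lemma eigenfunction_below_ground_state:
  assumes G: "compact_metric_graph G"
    and f: "eigenfunction G q \<nu> f f1" and pos: "\<And>p. p \<in> graph_points G \<Longrightarrow> 0 < f p"
    and w: "eigenfunction G q \<mu> w w1" and le: "\<mu> \<le> \<nu>" and ex: "(e, x) \<in> graph_points G"
  shows "w1 (e, x) = f1 (e, x) / f (e, x) * w (e, x)" "(\<nu> - \<mu>) * (w (e, x))\<^sup>2 = 0"
proof -
  have fin: "finite (edges G)" and L: "\<And>e. e \<in> edges G \<Longrightarrow> 0 < elen G e"
    using G by (auto simp: compact_metric_graph_def)
  define I where "I e x = (w1 (e, x) - f1 (e, x) / f (e, x) * w (e, x))\<^sup>2 + (\<nu> - \<mu>) * (w (e, x))\<^sup>2" for e x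
  have nonneg: "0 \<le> I e x" for e x using le by (simp add: I_def)
  define b where "b p = w p * w1 p - f1 p / f p * (w p)\<^sup>2" for p
  have fe: "ode_solution (elen G e) (\<lambda>x. q (e, x) - \<nu>) (\<lambda>x. f (e, x)) (\<lambda>x. f1 (e, x))"
    and we: "ode_solution (elen G e) (\<lambda>x. q (e, x) - \<mu>) (\<lambda>x. w (e, x)) (\<lambda>x. w1 (e, x))"
    and pe: "\<And>x. x \<in> {0..elen G e} \<Longrightarrow> 0 < f (e, x)" if "e \<in> edges G" for e
    using f w pos that by (auto simp: eigenfunction_def graph_points_def)
  have int: "(I e has_integral b (e, elen G e) - b (e, 0)) {0..elen G e}" if "e \<in> edges G" for e
    using picone_identity[OF less_imp_le[OF L] fe pe we] that unfolding I_def b_def by blast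
  obtain \<phi> \<psi> where \<phi>: "\<forall>e\<in>edges G. w (e, 0) = \<phi> (src G e) \<and> w (e, elen G e) = \<phi> (tgt G e)"
    and \<psi>: "\<forall>e\<in>edges G. f (e, 0) = \<psi> (src G e) \<and> f (e, elen G e) = \<psi> (tgt G e)"
    using f w unfolding eigenfunction_def glued_def by blast
  have "(\<Sum>e\<in>edges G. b (e, elen G e) - b (e, 0)) =
      (\<Sum>v\<in>vertices G. (\<phi> v)\<^sup>2 / \<psi> v * normal_derivative_sum G f1 v) -
      (\<Sum>v\<in>vertices G. \<phi> v * normal_derivative_sum G w1 v)"
    unfolding sum_vertices_normal_derivative[OF fin] sum_subtractf[symmetric]
    by (rule sum.cong) (use \<phi> \<psi> in \<open>auto simp: b_def mult.commute\<close>)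
  also have "\<dots> = 0" using f w by (simp add: eigenfunction_def)
  finally have "(\<Sum>e\<in>edges G. integral {0..elen G e} (I e)) = 0"
    using integral_unique[OF int] by simp
  moreover have "0 \<le> integral {0..elen G e} (I e)" for e
    using nonneg by (cases "I e integrable_on {0..elen G e}")
      (auto intro: integral_nonneg simp: not_integrable_integral)
  ultimately have zero: "integral {0..elen G e} (I e) = 0" if "e \<in> edges G" for e
    using sum_nonneg_eq_0_iff[OF fin, of "\<lambda>e. integral {0..elen G e} (I e)"] that by blast
  have e: "e \<in> edges G" "x \<in> {0..elen G e}" using ex by (auto simp: graph_points_def)
  have "continuous_on {0..elen G e} (I e)"
    unfolding I_def
    using ode_solution_continuous[OF fe[OF e(1)]] ode_solution_continuous[OF we[OF e(1)]] pe[OF e(1)]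
    by (intro continuous_intros) (auto simp: less_imp_neq[symmetric])
  then have "I e x = 0"
    using integral_eq_0_iff[of 0 "elen G e" "I e"] zero[OF e(1)] L[OF e(1)] nonneg e(2) by auto
  moreover have "0 \<le> (\<nu> - \<mu>) * (w (e, x))\<^sup>2" using le by simp
  ultimately show "(\<nu> - \<mu>) * (w (e, x))\<^sup>2 = 0" "w1 (e, x) = f1 (e, x) / f (e, x) * w (e, x)"
    unfolding I_def by (smt (verit) zero_le_power2 zero_eq_power2)+
qed

lemma eigenvalue_ge_ground_state:
  assumes G: "compact_metric_graph G" "continuous_potential G q"
    and f: "eigenfunction G q \<nu> f f1" "\<And>p. p \<in> graph_points G \<Longrightarrow> 0 < f p"
    and u: "u \<in> eigenspace G q \<mu>" "u \<noteq> 0"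
  shows "\<nu> \<le> \<mu>"
proof (rule ccontr)
  assume "\<not> \<nu> \<le> \<mu>"
  obtain u1 where u1: "eigenfunction G q \<mu> u u1" using u(1) eigenspace_iff_eigenfunction[OF G] by blast
  obtain p where p: "u p \<noteq> 0" using u(2) by (auto simp: fun_eq_iff)
  then have "p \<in> graph_points G" using u(1) eigenspace_vanishes_outside by blast
  then show False
    using eigenfunction_below_ground_state(2)[OF G(1) f u1, of "fst p" "snd p"] \<open>\<not> \<nu> \<le> \<mu>\<close> p by auto
qed

lemma walk_constant:
  assumes "\<And>e. e \<in> edges G \<Longrightarrow> r (src G e) = r (tgt G e)" "walk G v p w"
  shows "r v = r w"
  using assms(2)
proof (induction p arbitrary: v)
  case (Cons a p)
  then have "fst a \<in> edges G" "dstart G a = v" "walk G (dstop G a) p w" by simp_all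
  moreover from this(1) have "r (dstart G a) = r (dstop G a)"
    using assms(1)[of "fst a"] by (simp add: dstart_def dstop_def)
  ultimately show ?case using Cons.IH by metis
qed simp

text \<open>
  By \<open>eigenfunction_below_ground_state\<close> the quotient \<open>w / f\<close> has derivative \<open>0\<close> on each edge, so it is
  constant on the connected graph, and its value at \<open>(e0, x0)\<close> is \<open>0\<close>.
\<close>

lemma ground_state_simple:
  assumes G: "compact_metric_graph G"
    and f: "eigenfunction G q \<nu> f f1" and pos: "\<And>p. p \<in> graph_points G \<Longrightarrow> 0 < f p"
    and w: "eigenfunction G q \<mu> w w1" "\<mu> \<le> \<nu>"
    and p0: "(e0, x0) \<in> graph_points G" "w (e0, x0) = 0" and p: "p \<in> graph_points G"
  shows "w p = 0"
proof -
  obtain \<phi> \<psi> where \<phi>: "\<forall>e\<in>edges G. w (e, 0) = \<phi> (src G e) \<and> w (e, elen G e) = \<phi> (tgt G e)"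
    and \<psi>: "\<forall>e\<in>edges G. f (e, 0) = \<psi> (src G e) \<and> f (e, elen G e) = \<psi> (tgt G e)"
    using f w unfolding eigenfunction_def glued_def by blast
  have const: "w (e, x) / f (e, x) = w (e, 0) / f (e, 0)" if "(e, x) \<in> graph_points G" for e x
  proof -
    have e: "e \<in> edges G" "x \<in> {0..elen G e}" using that by (auto simp: graph_points_def)
    have "((\<lambda>x. w (e, x) / f (e, x)) has_real_derivative 0) (at y within {0..elen G e})"
      if y: "y \<in> {0..elen G e}" for y
    proof -
      have gp: "(e, y) \<in> graph_points G" using y e by (auto simp: graph_points_def)
      have "((\<lambda>x. w (e, x)) has_real_derivative w1 (e, y)) (at y within {0..elen G e})"
        "((\<lambda>x. f (e, x)) has_real_derivative f1 (e, y)) (at y within {0..elen G e})"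
        using f w e y by (auto simp: eigenfunction_def ode_solution_def)
      then show ?thesis
        using pos[OF gp] eigenfunction_below_ground_state(1)[OF G f pos w gp]
        by (auto intro!: derivative_eq_intros simp: field_simps)
    qed
    then obtain c where "\<And>y. y \<in> {0..elen G e} \<Longrightarrow> w (e, y) / f (e, y) = c"
      using has_field_derivative_zero_constant[of "{0..elen G e}" "\<lambda>x. w (e, x) / f (e, x)"] by auto
    then show ?thesis using e by auto
  qed
  define r where "r v = \<phi> v / \<psi> v" for v
  have gp: "(e, 0) \<in> graph_points G" "(e, elen G e) \<in> graph_points G" if "e \<in> edges G" for e
    using G that by (auto simp: compact_metric_graph_def graph_points_def less_imp_le)
  have r0: "w (e, x) / f (e, x) = r (src G e)" if "(e, x) \<in> graph_points G" for e x
    using const[OF that] that \<phi> \<psi> by (simp add: r_def graph_points_def)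
  have "r (src G e) = r (tgt G e)" if "e \<in> edges G" for e
    using r0[OF gp(2)[OF that]] that \<phi> \<psi> by (simp add: r_def)
  moreover obtain e x where ex: "p = (e, x)" by (cases p)
  moreover have "e \<in> edges G" "e0 \<in> edges G" using ex p p0 by (auto simp: graph_points_def)
  moreover then obtain s where "walk G (src G e0) s (src G e)"
    using G unfolding compact_metric_graph_def vertices_def by blast
  ultimately have "r (src G e) = r (src G e0)" using walk_constant[of G r] by metis
  then show ?thesis using r0[of e x] r0[OF p0(1)] p0(2) p pos[OF p] ex by simp
qed

lemma eigenfunction_restrict:
  assumes G: "compact_metric_graph G" and "eigenfunction G q \<mu> u u1"
  shows "eigenfunction G q \<mu> (\<lambda>p. if p \<in> graph_points G then u p else 0) u1"
proof -
  let ?u = "\<lambda>p. if p \<in> graph_points G then u p else 0"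
  have eq: "?u (e, x) = u (e, x)" if "e \<in> edges G" "x \<in> {0..elen G e}" for e x
    using that by (auto simp: graph_points_def)
  have "ode_solution (elen G e) (\<lambda>x. q (e, x) - \<mu>) (\<lambda>x. ?u (e, x)) (\<lambda>x. u1 (e, x))"
    if e: "e \<in> edges G" for e
    unfolding ode_solution_def
  proof (intro ballI conjI)
    fix x assume x: "x \<in> {0..elen G e}"
    have s: "((\<lambda>x. u (e, x)) has_real_derivative u1 (e, x)) (at x within {0..elen G e})"
      "((\<lambda>x. u1 (e, x)) has_real_derivative (q (e, x) - \<mu>) * u (e, x)) (at x within {0..elen G e})"
      using assms(2) e x by (auto simp: eigenfunction_def ode_solution_def)
    show "((\<lambda>x. ?u (e, x)) has_real_derivative u1 (e, x)) (at x within {0..elen G e})"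
      by (rule has_field_derivative_transform_within[OF s(1), of 1]) (use eq[OF e] x in auto)
    show "((\<lambda>x. u1 (e, x)) has_real_derivative (q (e, x) - \<mu>) * ?u (e, x)) (at x within {0..elen G e})"
      using s(2) eq[OF e x] by simp
  qed
  moreover have "glued G ?u"
    using assms(2) G eq unfolding eigenfunction_def glued_def compact_metric_graph_def
    by (auto simp: graph_points_def less_imp_le)
  ultimately show ?thesis using assms(2) by (auto simp: eigenfunction_def)
qed

lemma eigenval_1_ground_state:
  assumes G: "compact_metric_graph G" "continuous_potential G q"
    and f: "eigenfunction G q \<nu> f f1" "\<And>p. p \<in> graph_points G \<Longrightarrow> 0 < f p"
  shows "0 < eigen_mult G q \<nu>" "eigenval G q 1 = \<nu>"
    "\<And>\<mu>. 0 < eigen_mult G q \<mu> \<Longrightarrow> \<nu> \<le> \<mu>"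
proof -
  let ?f = "\<lambda>p. if p \<in> graph_points G then f p else 0"
  have "?f \<in> eigenspace G q \<nu>"
    unfolding eigenspace_iff_eigenfunction[OF G] using eigenfunction_restrict[OF G(1) f(1)] by auto
  moreover obtain p where "p \<in> graph_points G"
    using G(1) by (fastforce simp: compact_metric_graph_def graph_points_def)
  then have "?f \<noteq> 0" using f(2)[of p] by (auto dest!: fun_cong[of _ _ p])
  ultimately show pos: "0 < eigen_mult G q \<nu>" using eigen_mult_pos_iff[OF G] by blast
  show ge: "\<And>\<mu>. 0 < eigen_mult G q \<mu> \<Longrightarrow> \<nu> \<le> \<mu>"
    using eigenvalue_ge_ground_state[OF G f] eigen_mult_pos_iff[OF G] by blast
  show "eigenval G q 1 = \<nu>"
    unfolding eigenval_def
  proof (rule cInf_eq_minimum)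
    show "\<nu> \<in> {t. \<exists>A\<subseteq>eigenvals_upto G q t. finite A \<and> card A = 1}"
      using pos by (auto intro!: exI[of _ "{(\<nu>, 0)}"] simp: eigenvals_upto_def)
    fix t assume "t \<in> {t. \<exists>A\<subseteq>eigenvals_upto G q t. finite A \<and> card A = 1}"
    then obtain A where "A \<subseteq> eigenvals_upto G q t" "card A = 1" by blast
    then obtain \<mu> i where "(\<mu>, i) \<in> eigenvals_upto G q t" by (metis card_1_singletonE insert_subset old.prod.exhaust)
    then show "\<nu> \<le> t" using ge[of \<mu>] by (auto simp: eigenvals_upto_def)
  qed
qed

lemma eigenval_2_le:
  assumes G: "compact_metric_graph G" "continuous_potential G q"
    and f: "eigenfunction G q \<nu> f f1" "\<And>p. p \<in> graph_points G \<Longrightarrow> 0 < f p"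
    and L: "0 < eigen_mult G q \<Lambda>" "\<nu> < \<Lambda>"
  shows "eigenval G q 2 \<le> \<Lambda>"
  unfolding eigenval_def
proof (rule cInf_lower)
  note gs = eigenval_1_ground_state[OF G f]
  have "{(\<nu>, 0), (\<Lambda>, 0)} \<subseteq> eigenvals_upto G q \<Lambda>"
    using gs(1) L by (auto simp: eigenvals_upto_def)
  moreover have "card {(\<nu>, 0::nat), (\<Lambda>, 0)} = 2" using L by simp
  ultimately show "\<Lambda> \<in> {t. \<exists>A\<subseteq>eigenvals_upto G q t. finite A \<and> card A = 2}" by blast
  show "bdd_below {t. \<exists>A\<subseteq>eigenvals_upto G q t. finite A \<and> card A = 2}"
  proof (rule bdd_belowI[of _ \<nu>])
    fix t assume "t \<in> {t. \<exists>A\<subseteq>eigenvals_upto G q t. finite A \<and> card A = 2}"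
    then obtain A where A: "A \<subseteq> eigenvals_upto G q t" "card A = 2" by blast
    then have "A \<noteq> {}" by auto
    then obtain \<mu> i where "(\<mu>, i) \<in> eigenvals_upto G q t" using A by auto
    then show "\<nu> \<le> t" using gs(3)[of \<mu>] by (auto simp: eigenvals_upto_def)
  qed
qed

section \<open>Low-frequency solutions on a graph\<close>

text \<open>
  If \<open>sin (k L) \<noteq> 0\<close>, this is the solution of \<open>- f'' = k\<^sup>2 f\<close> on \<open>[0, L]\<close> with end values \<open>a\<close> and \<open>b\<close>.
\<close>

definition sine_interp :: "real \<Rightarrow> real \<Rightarrow> real \<Rightarrow> real \<Rightarrow> real \<Rightarrow> real" where
  "sine_interp k L a b x = (a * sin (k * (L - x)) + b * sin (k * x)) / sin (k * L)"

definition sine_interp1 :: "real \<Rightarrow> real \<Rightarrow> real \<Rightarrow> real \<Rightarrow> real \<Rightarrow> real" where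
  "sine_interp1 k L a b x = k * (b * cos (k * x) - a * cos (k * (L - x))) / sin (k * L)"

lemma ode_solution_sine_interp:
  "ode_solution L (\<lambda>x. 0 - k\<^sup>2) (sine_interp k L a b) (sine_interp1 k L a b)"
  unfolding ode_solution_def sine_interp_def sine_interp1_def
  by (cases "sin (k * L) = 0")
    (auto intro!: derivative_eq_intros simp: field_simps power2_eq_square)

lemma sine_interp_ends:
  assumes "sin (k * L) \<noteq> 0"
  shows "sine_interp k L a b 0 = a" "sine_interp k L a b L = b"
  using assms by (simp_all add: sine_interp_def)

lemma sine_interp_pos:
  assumes "0 < k" "0 < L" "k * L < pi" "0 < a" "0 < b" "x \<in> {0..L}"
  shows "0 < sine_interp k L a b x"
proof -
  have le: "k * x \<le> k * L" "k * (L - x) \<le> k * L" using assms by (auto intro!: mult_left_mono)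
  then have lt: "k * x < pi" "k * (L - x) < pi" using assms(3) by linarith+
  have "0 \<le> sin (k * x)" "0 \<le> sin (k * (L - x))"
    using assms(1,6) lt by (auto intro!: sin_ge_zero less_imp_le[OF lt(1)] less_imp_le[OF lt(2)])
  moreover have "0 < sin (k * x) \<or> 0 < sin (k * (L - x))"
    using assms lt by (cases "x = 0") (auto intro!: sin_gt_zero)
  ultimately have "0 < a * sin (k * (L - x)) + b * sin (k * x)"
    using assms(4,5) by (auto intro: add_pos_nonneg add_nonneg_pos)
  moreover have "0 < sin (k * L)" using assms by (intro sin_gt_zero) auto
  ultimately show ?thesis by (simp add: sine_interp_def)
qed

text \<open>
  The slopes of the interpolation at the ends of an edge are the currents in an electrical network:
  \<open>conductance\<close> weights the difference of the voltages, and \<open>leakage\<close>, which is of order \<open>k\<^sup>2\<close>, weights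
  the voltage itself.
\<close>

definition conductance :: "real \<Rightarrow> real \<Rightarrow> real" where
  "conductance k L = k / sin (k * L)"

definition leakage :: "real \<Rightarrow> real \<Rightarrow> real" where
  "leakage k L = k * (1 - cos (k * L)) / sin (k * L)"

lemma sine_interp1_ends:
  "sine_interp1 k L a b 0 = conductance k L * (b - a) + leakage k L * a"
  "- sine_interp1 k L a b L = conductance k L * (a - b) + leakage k L * b"
  by (simp_all add: sine_interp1_def conductance_def leakage_def divide_inverse algebra_simps)

lemma sine_interp1_linear:
  "sine_interp1 k L a b x = a * sine_interp1 k L 1 0 x + b * sine_interp1 k L 0 1 x"
  by (simp add: sine_interp1_def divide_inverse algebra_simps)

definition sine_network1 ::
  "('v, 'e) metric_graph \<Rightarrow> real \<Rightarrow> ('v \<Rightarrow> real) \<Rightarrow> 'e \<times> real \<Rightarrow> real" where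
  "sine_network1 G k \<phi> p =
     sine_interp1 k (elen G (fst p)) (\<phi> (src G (fst p))) (\<phi> (tgt G (fst p))) (snd p)"

lemma normal_derivative_sum_cong:
  assumes "\<And>e. e \<in> edges G \<Longrightarrow> src G e = v \<Longrightarrow> u1 (e, 0) = w1 (e, 0)"
    and "\<And>e. e \<in> edges G \<Longrightarrow> tgt G e = v \<Longrightarrow> u1 (e, elen G e) = w1 (e, elen G e)"
  shows "normal_derivative_sum G u1 v = normal_derivative_sum G w1 v"
  using assms by (auto simp: normal_derivative_sum_def intro!: arg_cong2[where f = "(+)"] sum.cong)

lemma normal_derivative_sum_sum:
  "normal_derivative_sum G (\<lambda>p. \<Sum>w\<in>W. a w * h w p) v = (\<Sum>w\<in>W. a w * normal_derivative_sum G (h w) v)"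
  by (simp add: normal_derivative_sum_def sum_distrib_left sum.distrib distrib_left
      sum.swap[of _ W] sum_negf[symmetric])

lemma sine_network_linear:
  assumes "finite (vertices G)"
  shows "normal_derivative_sum G (sine_network1 G k \<phi>) v =
    (\<Sum>w\<in>vertices G. \<phi> w * normal_derivative_sum G (sine_network1 G k (\<lambda>x. if x = w then 1 else 0)) v)"
proof -
  let ?\<delta> = "\<lambda>w x. if x = w then 1 else 0 :: real"
  have "sine_network1 G k \<phi> (e, x) = (\<Sum>w\<in>vertices G. \<phi> w * sine_network1 G k (?\<delta> w) (e, x))"
    if e: "e \<in> edges G" for e x
  proof -
    have pick: "(\<Sum>w\<in>vertices G. \<phi> w * ?\<delta> w y) = \<phi> y" if "y \<in> vertices G" for y
    proof -
      have "(\<Sum>w\<in>vertices G. \<phi> w * ?\<delta> w y) = (\<Sum>w\<in>vertices G. if y = w then \<phi> w else 0)"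
        by (rule sum.cong) auto
      then show ?thesis using assms that by simp
    qed
    have ends: "src G e \<in> vertices G" "tgt G e \<in> vertices G" using e by (auto simp: vertices_def)
    define A B where "A = sine_interp1 k (elen G e) 1 0 x" and "B = sine_interp1 k (elen G e) 0 1 x"
    have AB: "sine_network1 G k \<psi> (e, x) = \<psi> (src G e) * A + \<psi> (tgt G e) * B" for \<psi>
      unfolding sine_network1_def fst_conv snd_conv A_def B_def by (rule sine_interp1_linear)
    have "(\<Sum>w\<in>vertices G. \<phi> w * sine_network1 G k (?\<delta> w) (e, x)) =
        (\<Sum>w\<in>vertices G. \<phi> w * ?\<delta> w (src G e)) * A + (\<Sum>w\<in>vertices G. \<phi> w * ?\<delta> w (tgt G e)) * B"
      unfolding AB distrib_left sum.distrib sum_distrib_right mult.assoc ..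
    then show ?thesis unfolding pick[OF ends(1)] pick[OF ends(2)] AB[of \<phi>] ..
  qed
  then have "normal_derivative_sum G (sine_network1 G k \<phi>) v =
      normal_derivative_sum G (\<lambda>p. \<Sum>w\<in>vertices G. \<phi> w * sine_network1 G k (?\<delta> w) p) v"
    by (intro normal_derivative_sum_cong) simp
  then show ?thesis by (simp add: normal_derivative_sum_sum)
qed

text \<open>
  Dropping the condition at the one vertex \<open>z\<close> leaves fewer equations than vertex values. The
  solution is scaled so that its largest absolute value is attained with positive sign.
\<close>

lemma sine_network_nontrivial:
  assumes G: "compact_metric_graph G" and z: "z \<in> vertices G"
  shows "\<exists>\<phi> m. m \<in> vertices G \<and> \<phi> m = 1 \<and> (\<forall>v\<in>vertices G. \<bar>\<phi> v\<bar> \<le> 1) \<and>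
    (\<forall>v\<in>vertices G. v \<noteq> z \<longrightarrow> normal_derivative_sum G (sine_network1 G k \<phi>) v = 0)"
proof -
  note fin = finite_vertices[OF G]
  let ?a = "\<lambda>v w. normal_derivative_sum G (sine_network1 G k (\<lambda>x. if x = w then 1 else 0)) v"
  have "\<exists>x. (\<exists>j\<in>vertices G. x j \<noteq> 0) \<and> (\<forall>i\<in>vertices G - {z}. (\<Sum>j\<in>vertices G. ?a i j * x j) = 0)"
    by (rule homogeneous_system_nontrivial) (use fin z in \<open>auto simp: card_gt_0_iff card_Diff_singleton intro!: diff_less\<close>)
  then obtain x where x: "\<exists>j\<in>vertices G. x j \<noteq> 0"
    "\<And>i. i \<in> vertices G - {z} \<Longrightarrow> (\<Sum>j\<in>vertices G. ?a i j * x j) = 0" by blast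
  obtain m where m: "m \<in> vertices G" "\<And>v. v \<in> vertices G \<Longrightarrow> \<bar>x v\<bar> \<le> \<bar>x m\<bar>"
  proof -
    have "Max ((\<lambda>v. \<bar>x v\<bar>) ` vertices G) \<in> (\<lambda>v. \<bar>x v\<bar>) ` vertices G"
      using fin z by (intro Max_in) auto
    then obtain m where "m \<in> vertices G" "Max ((\<lambda>v. \<bar>x v\<bar>) ` vertices G) = \<bar>x m\<bar>" by auto
    with that show thesis using fin by (metis Max_ge finite_imageI imageI)
  qed
  then have xm: "x m \<noteq> 0" using x(1) by force
  have "\<bar>x v / x m\<bar> \<le> 1" if "v \<in> vertices G" for v
    using m(2)[OF that] xm by (simp add: abs_divide)
  moreover have "normal_derivative_sum G (sine_network1 G k (\<lambda>v. x v / x m)) v = 0"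
    if "v \<in> vertices G" "v \<noteq> z" for v
  proof -
    have "normal_derivative_sum G (sine_network1 G k (\<lambda>v. x v / x m)) v =
        (\<Sum>w\<in>vertices G. ?a v w * x w) / x m"
      by (subst sine_network_linear[OF fin]) (simp add: sum_divide_distrib mult.commute)
    also have "\<dots> = 0" using x(2)[of v] that by simp
    finally show ?thesis .
  qed
  ultimately show ?thesis
    using m(1) xm by (intro exI[of _ "\<lambda>v. x v / x m"] exI[of _ m]) simp
qed

lemma walk_increment:
  assumes "\<And>e. e \<in> edges G \<Longrightarrow> \<bar>\<phi> (src G e) - \<phi> (tgt G e)\<bar> \<le> \<epsilon>" "walk G v p w"
  shows "\<bar>\<phi> v - \<phi> w\<bar> \<le> real (length p) * (\<epsilon> :: real)"
  using assms(2)
proof (induction p arbitrary: v)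
  case (Cons a p)
  then have a: "fst a \<in> edges G" "dstart G a = v" "walk G (dstop G a) p w" by simp_all
  then have "\<bar>\<phi> v - \<phi> (dstop G a)\<bar> \<le> \<epsilon>"
    using assms(1)[OF a(1)] by (auto simp: dstart_def dstop_def abs_minus_commute)
  with Cons.IH[OF a(3)] show ?case by (simp add: algebra_simps)
qed simp

lemma bounded_walks:
  assumes "compact_metric_graph G"
  obtains N where "\<And>v w. v \<in> vertices G \<Longrightarrow> w \<in> vertices G \<Longrightarrow> \<exists>p. walk G v p w \<and> length p \<le> N"
proof -
  have fin: "finite (vertices G \<times> vertices G)" using finite_vertices[OF assms] by simp
  have "\<exists>P. \<forall>x\<in>vertices G \<times> vertices G. walk G (fst x) (P x) (snd x)"
    by (rule bchoice) (use assms in \<open>auto simp: compact_metric_graph_def\<close>)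
  then obtain P where P: "\<forall>x\<in>vertices G \<times> vertices G. walk G (fst x) (P x) (snd x)" ..
  show thesis
  proof (rule that)
    fix v w assume vw: "v \<in> vertices G" "w \<in> vertices G"
    have "length (P (v, w)) \<le> (\<Sum>x\<in>vertices G \<times> vertices G. length (P x))"
      by (rule member_le_sum) (use vw fin in auto)
    then show "\<exists>p. walk G v p w \<and> length p \<le> (\<Sum>x\<in>vertices G \<times> vertices G. length (P x))"
      using P vw by force
  qed
qed

text \<open>
  Testing the vertex conditions with \<open>1\<close> and with \<open>\<phi>\<close> gives two identities. The first computes the
  current at \<open>z\<close> as the total leakage; with it the second bounds the energy
  \<open>\<Sum> conductance \<cdot> (difference of \<phi>)\<^sup>2\<close> by four times the sum of the leakages.
\<close>

lemma sine_network_almost_constant: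
  assumes G: "compact_metric_graph G" and k: "0 < k" "\<And>e. e \<in> edges G \<Longrightarrow> k * elen G e < pi"
    and z: "z \<in> vertices G" and \<phi>: "\<And>v. v \<in> vertices G \<Longrightarrow> \<bar>\<phi> v\<bar> \<le> 1"
    and F: "\<And>v. v \<in> vertices G \<Longrightarrow> v \<noteq> z \<Longrightarrow> normal_derivative_sum G (sine_network1 G k \<phi>) v = 0"
    and e: "e \<in> edges G"
  shows "\<bar>\<phi> (src G e) - \<phi> (tgt G e)\<bar> \<le>
      sqrt (4 * (\<Sum>e\<in>edges G. leakage k (elen G e)) * (\<Sum>e\<in>edges G. elen G e))"
    and "normal_derivative_sum G (sine_network1 G k \<phi>) z =
      (\<Sum>e\<in>edges G. leakage k (elen G e) * (\<phi> (src G e) + \<phi> (tgt G e)))"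
proof -
  have fin: "finite (edges G)" and L: "\<And>e. e \<in> edges G \<Longrightarrow> 0 < elen G e"
    using G by (auto simp: compact_metric_graph_def)
  let ?F = "normal_derivative_sum G (sine_network1 G k \<phi>)"
  let ?c = "\<lambda>e. conductance k (elen G e)" and ?d = "\<lambda>e. leakage k (elen G e)"
  let ?s = "\<lambda>e. \<phi> (src G e)" and ?t = "\<lambda>e. \<phi> (tgt G e)"
  have sin: "0 < sin (k * elen G e)" if "e \<in> edges G" for e
    using L[OF that] k(1) k(2)[OF that] by (intro sin_gt_zero) auto
  have d: "0 \<le> ?d e" if "e \<in> edges G" for e
    using sin[OF that] k(1) by (simp add: leakage_def)
  \<comment> \<open>a lower bound that does not depend on \<open>k\<close>, so that small energy means small differences\<close>
  have c: "1 / elen G e \<le> ?c e" if "e \<in> edges G" for e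
  proof -
    have "sin (k * elen G e) \<le> k * elen G e" using L[OF that] k(1) by (intro sin_x_le_x) auto
    then show ?thesis using sin[OF that] L[OF that] by (simp add: conductance_def field_simps)
  qed
  have cpos: "0 \<le> ?c e" if "e \<in> edges G" for e using c[OF that] L[OF that]
    by (meson divide_nonneg_pos dual_order.trans zero_le_one)
  have ends: "sine_network1 G k \<phi> (e, 0) = ?c e * (?t e - ?s e) + ?d e * ?s e"
    "- sine_network1 G k \<phi> (e, elen G e) = ?c e * (?s e - ?t e) + ?d e * ?t e" for e
    using sine_interp1_ends by (simp_all add: sine_network1_def)
  have only_z: "(\<Sum>v\<in>vertices G. g v * ?F v) = g z * ?F z" for g :: "'a \<Rightarrow> real"
  proof -
    have "(\<Sum>v\<in>vertices G. g v * ?F v) = (\<Sum>v\<in>{z}. g v * ?F v)"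
      by (rule sum.mono_neutral_right) (use finite_vertices[OF G] z F in auto)
    then show ?thesis by simp
  qed
  have "?F z = (\<Sum>v\<in>vertices G. 1 * ?F v)" using only_z[of "\<lambda>_. 1"] by simp
  also have "\<dots> = (\<Sum>e\<in>edges G. ?d e * (?s e + ?t e))"
    unfolding sum_vertices_normal_derivative[OF fin]
  proof (rule sum.cong[OF refl])
    fix e
    show "1 * sine_network1 G k \<phi> (e, 0) - 1 * sine_network1 G k \<phi> (e, elen G e) = ?d e * (?s e + ?t e)"
      using ends[of e] by (simp add: algebra_simps)
  qed
  finally show Fz: "?F z = (\<Sum>e\<in>edges G. ?d e * (?s e + ?t e))" .
  have "\<phi> z * ?F z = (\<Sum>e\<in>edges G. ?d e * ((?s e)\<^sup>2 + (?t e)\<^sup>2) - ?c e * (?s e - ?t e)\<^sup>2)"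
    unfolding only_z[symmetric] sum_vertices_normal_derivative[OF fin]
  proof (rule sum.cong[OF refl])
    fix e
    have "?s e * sine_network1 G k \<phi> (e, 0) + ?t e * (- sine_network1 G k \<phi> (e, elen G e)) =
        ?d e * ((?s e)\<^sup>2 + (?t e)\<^sup>2) - ?c e * (?s e - ?t e)\<^sup>2"
      unfolding ends by (simp add: power2_eq_square algebra_simps)
    then show "?s e * sine_network1 G k \<phi> (e, 0) - ?t e * sine_network1 G k \<phi> (e, elen G e) =
        ?d e * ((?s e)\<^sup>2 + (?t e)\<^sup>2) - ?c e * (?s e - ?t e)\<^sup>2" by simp
  qed
  then have energy: "(\<Sum>e\<in>edges G. ?c e * (?s e - ?t e)\<^sup>2) =
      (\<Sum>e\<in>edges G. ?d e * ((?s e)\<^sup>2 + (?t e)\<^sup>2)) - \<phi> z * ?F z"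
    by (simp add: sum_subtractf)
  have b: "\<bar>?s e\<bar> \<le> 1" "\<bar>?t e\<bar> \<le> 1" if "e \<in> edges G" for e
    using \<phi> that by (auto simp: vertices_def)
  have "(\<Sum>e\<in>edges G. ?d e * ((?s e)\<^sup>2 + (?t e)\<^sup>2)) \<le> (\<Sum>e\<in>edges G. ?d e * 2)"
  proof (intro sum_mono mult_left_mono)
    fix e assume "e \<in> edges G"
    from b[OF this] have "(?s e)\<^sup>2 \<le> 1" "(?t e)\<^sup>2 \<le> 1" by (auto simp: abs_square_le_1)
    then show "(?s e)\<^sup>2 + (?t e)\<^sup>2 \<le> 2" by simp
  qed (use d in auto)
  moreover have "\<bar>\<phi> z * ?F z\<bar> \<le> (\<Sum>e\<in>edges G. ?d e * 2)"
  proof -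
    have "\<bar>?F z\<bar> \<le> (\<Sum>e\<in>edges G. \<bar>?d e * (?s e + ?t e)\<bar>)" unfolding Fz by (rule sum_abs)
    also have "\<dots> \<le> (\<Sum>e\<in>edges G. ?d e * 2)"
    proof (rule sum_mono)
      fix e assume e: "e \<in> edges G"
      from b[OF this] have "\<bar>?s e + ?t e\<bar> \<le> 2" by linarith
      then show "\<bar>?d e * (?s e + ?t e)\<bar> \<le> ?d e * 2" using d[OF e] by (simp add: abs_mult mult_left_mono)
    qed
    moreover have "\<bar>\<phi> z\<bar> * \<bar>?F z\<bar> \<le> 1 * \<bar>?F z\<bar>" using \<phi>[OF z] by (intro mult_right_mono) auto
    ultimately show ?thesis by (simp add: abs_mult)
  qed
  ultimately have energy_le: "(\<Sum>e\<in>edges G. ?c e * (?s e - ?t e)\<^sup>2) \<le> 4 * (\<Sum>e\<in>edges G. ?d e)"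
    unfolding energy sum_distrib_right[symmetric] by linarith
  have "(?s e - ?t e)\<^sup>2 / elen G e \<le> ?c e * (?s e - ?t e)\<^sup>2"
    using mult_right_mono[OF c[OF e], of "(?s e - ?t e)\<^sup>2"] by simp
  also have "\<dots> \<le> (\<Sum>e\<in>edges G. ?c e * (?s e - ?t e)\<^sup>2)"
    by (rule member_le_sum) (use e fin cpos in auto)
  finally have "(?s e - ?t e)\<^sup>2 \<le> 4 * (\<Sum>e\<in>edges G. ?d e) * elen G e"
    using energy_le L[OF e] by (simp add: pos_divide_le_eq)
      (meson dual_order.trans less_imp_le mult_right_mono)
  also have "\<dots> \<le> 4 * (\<Sum>e\<in>edges G. ?d e) * (\<Sum>e\<in>edges G. elen G e)"
    by (intro mult_left_mono member_le_sum) (use e fin L d in \<open>auto intro: sum_nonneg less_imp_le\<close>)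
  finally show "\<bar>?s e - ?t e\<bar> \<le> sqrt (4 * (\<Sum>e\<in>edges G. ?d e) * (\<Sum>e\<in>edges G. elen G e))"
    by (metis real_sqrt_abs real_sqrt_le_iff)
qed

lemma leakage_tendsto_0: "0 < L \<Longrightarrow> ((\<lambda>k. leakage k L) \<longlongrightarrow> 0) (at_right 0)"
  unfolding leakage_def by real_asymp

text \<open>
  As \<open>k\<close> tends to \<open>0\<close>, so do the leakages and with them the differences along edges. Two vertices are
  joined by a walk of bounded length, and the value \<open>1\<close> is attained, so every value is at least \<open>1 / 2\<close>.
\<close>

lemma low_frequency_network:
  assumes G: "compact_metric_graph G" and z: "z \<in> vertices G" and \<eta>: "0 < \<eta>"
  shows "\<forall>\<^sub>F k in at_right 0. k\<^sup>2 < \<eta> \<and> (\<forall>e\<in>edges G. k * elen G e < pi) \<and>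
    (\<Sum>e\<in>edges G. leakage k (elen G e)) < \<eta> \<and>
    (\<exists>\<phi>. (\<forall>v\<in>vertices G. 1 / 2 \<le> \<phi> v \<and> \<phi> v \<le> 1) \<and>
      (\<forall>v\<in>vertices G. v \<noteq> z \<longrightarrow> normal_derivative_sum G (sine_network1 G k \<phi>) v = 0))"
proof -
  have fin: "finite (edges G)" and L: "\<And>e. e \<in> edges G \<Longrightarrow> 0 < elen G e"
    using G by (auto simp: compact_metric_graph_def)
  obtain N where N: "\<And>v w. v \<in> vertices G \<Longrightarrow> w \<in> vertices G \<Longrightarrow> \<exists>p. walk G v p w \<and> length p \<le> N"
    using bounded_walks[OF G] by blast
  let ?S = "\<lambda>k. \<Sum>e\<in>edges G. leakage k (elen G e)"
  let ?\<epsilon> = "\<lambda>k. sqrt (4 * ?S k * (\<Sum>e\<in>edges G. elen G e))"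
  have S: "(?S \<longlongrightarrow> 0) (at_right 0)"
    using tendsto_sum[of "edges G" "\<lambda>e k. leakage k (elen G e)" "\<lambda>_. 0" "at_right 0"] leakage_tendsto_0 L
    by simp
  have "((\<lambda>k. real N * ?\<epsilon> k) \<longlongrightarrow> real N * sqrt (4 * 0 * (\<Sum>e\<in>edges G. elen G e))) (at_right 0)"
    by (intro tendsto_intros S)
  then have "((\<lambda>k. real N * ?\<epsilon> k) \<longlongrightarrow> 0) (at_right 0)" by simp
  then have e1: "\<forall>\<^sub>F k in at_right 0. real N * ?\<epsilon> k < 1 / 2" by (rule order_tendstoD) simp
  have e2: "\<forall>\<^sub>F k in at_right 0. ?S k < \<eta>" using S \<eta> by (rule order_tendstoD)
  have "((\<lambda>k::real. k\<^sup>2) \<longlongrightarrow> 0) (at_right 0)" by real_asymp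
  then have e3: "\<forall>\<^sub>F k::real in at_right 0. k\<^sup>2 < \<eta>" using \<eta> by (rule order_tendstoD)
  have "\<forall>\<^sub>F k in at_right 0. k * elen G e < pi" for e
  proof -
    have "((\<lambda>k::real. k * elen G e) \<longlongrightarrow> 0 * elen G e) (at_right 0)" by (intro tendsto_intros)
    then show ?thesis by (rule order_tendstoD) simp
  qed
  then have e4: "\<forall>\<^sub>F k in at_right 0. \<forall>e\<in>edges G. k * elen G e < pi"
    using fin by (simp add: eventually_ball_finite)
  have e5: "\<forall>\<^sub>F k::real in at_right 0. 0 < k" by (rule eventually_at_right_less)
  show ?thesis
    using e1 e2 e3 e4 e5
  proof eventually_elim
    case (elim k)
    obtain \<phi> m where m: "m \<in> vertices G" "\<phi> m = 1" and \<phi>: "\<And>v. v \<in> vertices G \<Longrightarrow> \<bar>\<phi> v\<bar> \<le> 1"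
      and F: "\<And>v. v \<in> vertices G \<Longrightarrow> v \<noteq> z \<Longrightarrow> normal_derivative_sum G (sine_network1 G k \<phi>) v = 0"
      using sine_network_nontrivial[OF G z, of k] by blast
    have "1 / 2 \<le> \<phi> v" if v: "v \<in> vertices G" for v
    proof -
      obtain p where p: "walk G m p v" "length p \<le> N" using N[OF m(1) v] by blast
      have "\<bar>\<phi> m - \<phi> v\<bar> \<le> real (length p) * ?\<epsilon> k"
        by (rule walk_increment[OF _ p(1)])
          (rule sine_network_almost_constant(1)[OF G _ _ z \<phi> F], use elim in auto)
      also have "\<dots> \<le> real N * ?\<epsilon> k"
      proof (rule mult_right_mono)
        have "0 \<le> leakage k (elen G e)" if "e \<in> edges G" for e
        proof -
          have "0 < sin (k * elen G e)" using L[OF that] elim that by (intro sin_gt_zero) auto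
          then show ?thesis using elim by (simp add: leakage_def)
        qed
        then have "0 \<le> 4 * ?S k * (\<Sum>e\<in>edges G. elen G e)"
          using L by (intro mult_nonneg_nonneg sum_nonneg) (auto intro: less_imp_le)
        then show "0 \<le> ?\<epsilon> k" by simp
      qed (use p in simp)
      finally show ?thesis using elim m(2) by linarith
    qed
    moreover have "\<phi> v \<le> 1" if "v \<in> vertices G" for v using \<phi>[OF that] by linarith
    ultimately show ?case using elim F by (intro conjI exI[of _ \<phi>]) auto
  qed
qed

section \<open>The potential and its ground state\<close>

lemma normal_derivative_sum_pendant:
  assumes "pendant_edge G a"
  shows "normal_derivative_sum G u1 (dstop G a) =
    (if snd a then - u1 (fst a, elen G (fst a)) else u1 (fst a, 0))"
  using assms unfolding pendant_edge_def normal_derivative_sum_def by (auto split: if_splits)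

lemma pendant_edge_other_ends:
  assumes "pendant_edge G a" "e \<in> edges G" "e \<noteq> fst a"
  shows "src G e \<noteq> dstop G a" "tgt G e \<noteq> dstop G a"
  using assms unfolding pendant_edge_def by (auto split: if_splits)

text \<open>
  Here \<open>y\<close> is the distance from the inner vertex, \<open>m0\<close> the logarithmic derivative that the rest of the
  graph dictates at \<open>y = 0\<close>, and \<open>P\<close> the ground state on the edge. The ansatz is
  \<open>m = P' / P = m0 - s y + c y\<^sup>3\<close> with \<open>Q = m' + m\<^sup>2 + \<nu>\<close>. The condition \<open>Q 0 = 0\<close> forces
  \<open>s = \<nu> + m0\<^sup>2\<close>, and \<open>m L = 0\<close>, the vertex condition at the leaf, determines \<open>c \<ge> 0\<close>. The correction is
  cubic, not quadratic, because then \<open>Q'' = 6 c (1 + 2 y m) + 2 m'\<^sup>2\<close>, which is nonnegative as soon as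
  \<open>m\<close> is small. Since \<open>m0 \<le> 0\<close>, also \<open>Q' 0 = - 2 m0 s \<ge> 0\<close>, so that \<open>Q\<close> is nondecreasing.
\<close>

lemma pendant_edge_potential:
  fixes L M :: real
  assumes "0 < L" "0 < M"
  obtains \<epsilon> where "0 < \<epsilon>"
    "\<And>\<nu> m0. 0 < \<nu> \<Longrightarrow> \<nu> < \<epsilon> \<Longrightarrow> - \<epsilon> < m0 \<Longrightarrow> m0 \<le> 0 \<Longrightarrow>
      \<exists>Q P P1. Q 0 = 0 \<and> continuous_on {0..L} Q \<and> convex_on {0..L} Q \<and> mono_on {0..L} Q \<and> (\<forall>y\<in>{0..L}. Q y \<le> M) \<and>
        ode_solution L (\<lambda>y. Q y - \<nu>) P P1 \<and> (\<forall>y. 0 < P y) \<and> P 0 = 1 \<and> P1 0 = m0 \<and> P1 L = 0"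
proof -
  \<comment> \<open>the bound on \<open>\<tau>\<close> below: \<open>4 L t \<le> 1\<close> is used for the convexity of \<open>Q\<close>, \<open>t (3 / L + 4) \<le> M\<close> for \<open>Q \<le> M\<close>\<close>
  define t where "t = min 1 (min (1 / (4 * L)) (M / (3 / L + 4)))"
  have t: "0 < t" "t \<le> 1" "4 * L * t \<le> 1" "t * (3 / L + 4) \<le> M"
  proof -
    have "0 < 3 / L + 4" using assms by (simp add: add_pos_pos)
    then show "0 < t" using assms by (simp add: t_def)
    show "t \<le> 1" by (simp add: t_def)
    have "t \<le> 1 / (4 * L)" "t \<le> M / (3 / L + 4)" by (simp_all add: t_def)
    then show "4 * L * t \<le> 1" "t * (3 / L + 4) \<le> M"
      using assms \<open>0 < 3 / L + 4\<close> by (simp_all add: field_simps)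
  qed
  define \<epsilon> where "\<epsilon> = min 1 (t / (1 + 2 * L))"
  have \<epsilon>: "0 < \<epsilon>" "\<epsilon> \<le> 1" "\<epsilon> * (1 + 2 * L) \<le> t"
  proof -
    show "0 < \<epsilon>" "\<epsilon> \<le> 1" using t assms by (simp_all add: \<epsilon>_def)
    have "\<epsilon> \<le> t / (1 + 2 * L)" by (simp add: \<epsilon>_def)
    then show "\<epsilon> * (1 + 2 * L) \<le> t" using assms by (simp add: pos_le_divide_eq)
  qed
  show thesis
  proof (rule that[OF \<epsilon>(1)])
    fix \<nu> m0 :: real assume \<nu>: "0 < \<nu>" "\<nu> < \<epsilon>" and m0: "- \<epsilon> < m0" "m0 \<le> 0"
    define s where "s = \<nu> + m0\<^sup>2"
    define c where "c = (s * L - m0) / L ^ 3"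
    define m where "m y = m0 - s * y + c * y ^ 3" for y
    define m1 where "m1 y = - s + 3 * c * y\<^sup>2" for y
    define Q where "Q y = m1 y + (m y)\<^sup>2 + \<nu>" for y
    define Q1 where "Q1 y = 6 * c * y + 2 * m y * m1 y" for y
    define Q2 where "Q2 y = 6 * c * (1 + 2 * y * m y) + 2 * (m1 y)\<^sup>2" for y
    define P where "P y = exp (m0 * y - s * y\<^sup>2 / 2 + c * y ^ 4 / 4)" for y
    have s: "0 < s" using \<nu> by (simp add: s_def add_pos_nonneg)
    have "0 \<le> s * L" using s assms by simp
    then have c: "0 \<le> c" using m0 assms by (simp add: c_def)
    have cL: "c * L ^ 3 = s * L - m0" using assms by (simp add: c_def)
    \<comment> \<open>\<open>\<tau>\<close> controls \<open>m\<close>, and it is small with \<open>\<nu>\<close> and \<open>m0\<close>\<close>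
    define \<tau> where "\<tau> = s * L - m0"
    have m0sq: "m0\<^sup>2 \<le> \<epsilon>"
    proof -
      have "(- m0) * (- m0) \<le> \<epsilon> * 1" using m0 \<epsilon>(2) by (intro mult_mono) auto
      then show ?thesis by (simp add: power2_eq_square)
    qed
    have "s * L \<le> (2 * \<epsilon>) * L" using m0sq \<nu> assms by (intro mult_right_mono) (auto simp: s_def)
    moreover have "2 * \<epsilon> * L + \<epsilon> \<le> t" using \<epsilon>(3) by (simp add: algebra_simps)
    ultimately have \<tau>: "0 \<le> \<tau>" "\<tau> \<le> t"
      using m0 \<open>0 \<le> s * L\<close> unfolding \<tau>_def by linarith+
    have mb: "\<bar>m y\<bar> \<le> 2 * \<tau>" if y: "y \<in> {0..L}" for y
    proof -
      have "s * y \<le> s * L" "c * y ^ 3 \<le> c * L ^ 3" "0 \<le> s * y" "0 \<le> c * y ^ 3"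
        using y s c by (auto intro!: mult_left_mono power_mono)
      then have "s * y \<le> \<tau> + m0" "c * y ^ 3 \<le> \<tau>" "0 \<le> s * y" "0 \<le> c * y ^ 3"
        by (simp_all only: cL \<tau>_def diff_add_cancel)
      then show ?thesis using m0 \<tau> unfolding m_def by linarith
    qed
    have dm: "(m has_real_derivative m1 y) (at y)" for y
      unfolding m_def m1_def by (auto intro!: derivative_eq_intros)
    have dQ: "(Q has_real_derivative Q1 y) (at y)" for y
      unfolding Q_def Q1_def m1_def
      by (auto intro!: derivative_eq_intros dm simp: m1_def power2_eq_square)
    have dQ1: "(Q1 has_real_derivative Q2 y) (at y)" for y
      unfolding Q1_def Q2_def m1_def
      by (auto intro!: derivative_eq_intros dm simp: m1_def power2_eq_square algebra_simps)
    have Q2: "0 \<le> Q2 y" if y: "y \<in> {0..L}" for y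
    proof -
      have "y * \<bar>m y\<bar> \<le> L * (2 * t)" using y mb[OF y] \<tau> by (intro mult_mono) auto
      then have "\<bar>y * m y\<bar> \<le> 1 / 2" using t(3) y by (simp add: abs_mult)
      then have "0 \<le> 1 + 2 * y * m y" by linarith
      then show ?thesis using c by (simp add: Q2_def)
    qed
    have Q0: "Q 0 = 0" by (simp add: Q_def m1_def m_def s_def)
    have "0 \<le> Q1 0" using s m0 by (simp add: Q1_def m_def m1_def mult_nonpos_nonneg)
    then have Q1: "0 \<le> Q1 y" if "y \<in> {0..L}" for y
    proof -
      have "Q1 0 \<le> Q1 y"
      proof (rule DERIV_nonneg_imp_nondecreasing[where f = Q1])
        fix x assume "0 \<le> x" "x \<le> y"
        then have "0 \<le> Q2 x" using Q2 that by simp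
        with dQ1 show "\<exists>d. (Q1 has_real_derivative d) (at x) \<and> 0 \<le> d" by blast
      qed (use that in simp)
      with \<open>0 \<le> Q1 0\<close> show ?thesis by simp
    qed
    have mono: "mono_on {0..L} Q"
    proof (rule mono_onI)
      fix x y assume xy: "x \<in> {0..L}" "y \<in> {0..L}" "x \<le> y"
      show "Q x \<le> Q y"
      proof (rule DERIV_nonneg_imp_nondecreasing[where f = Q])
        fix z assume "x \<le> z" "z \<le> y"
        then have "0 \<le> Q1 z" using Q1 xy by simp
        with dQ show "\<exists>d. (Q has_real_derivative d) (at z) \<and> 0 \<le> d" by blast
      qed (rule xy(3))
    qed
    have conv: "convex_on {0..L} Q"
      by (rule f''_ge0_imp_convex[of _ Q Q1 Q2]) (use dQ dQ1 Q2 in auto)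
    have cont: "continuous_on {0..L} Q"
      using dQ by (auto intro!: DERIV_atLeastAtMost_imp_continuous_on)
    have QM: "Q y \<le> M" if y: "y \<in> {0..L}" for y
    proof -
      have "Q y \<le> Q L" using mono y by (auto simp: mono_on_def)
      also have "m L = 0" using cL by (simp add: m_def)
      then have "Q L = 3 * (c * L\<^sup>2) - m0\<^sup>2" by (simp add: Q_def m1_def s_def)
      also have "c * L\<^sup>2 = \<tau> / L" using assms by (simp add: c_def \<tau>_def power2_eq_square power3_eq_cube)
      also have "3 * (\<tau> / L) - m0\<^sup>2 \<le> t * (3 / L)"
      proof -
        have "3 * (\<tau> / L) \<le> t * (3 / L)" using \<tau> assms by (simp add: field_simps)
        then show ?thesis using zero_le_power2[of m0] by linarith
      qed
      also have "\<dots> \<le> t * (3 / L + 4)" using t(1) by (intro mult_left_mono) simp_all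
      finally show ?thesis using t(4) by simp
    qed
    have dP: "(P has_real_derivative m y * P y) (at y)" for y
      unfolding P_def m_def by (auto intro!: derivative_eq_intros simp: algebra_simps)
    have "((\<lambda>y. m y * P y) has_real_derivative (Q y - \<nu>) * P y) (at y)" for y
      by (auto intro!: derivative_eq_intros dm dP simp: Q_def algebra_simps power2_eq_square)
    then have "ode_solution L (\<lambda>y. Q y - \<nu>) P (\<lambda>y. m y * P y)"
      using dP by (auto simp: ode_solution_def intro: has_field_derivative_at_within)
    moreover have "m L = 0" using cL by (simp add: m_def)
    moreover have "P 0 = 1" "m 0 = m0" by (simp_all add: P_def m_def)
    ultimately show "\<exists>Q P P1. Q 0 = 0 \<and> continuous_on {0..L} Q \<and> convex_on {0..L} Q \<and> mono_on {0..L} Q \<and> (\<forall>y\<in>{0..L}. Q y \<le> M) \<and>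
        ode_solution L (\<lambda>y. Q y - \<nu>) P P1 \<and> (\<forall>y. 0 < P y) \<and> P 0 = 1 \<and> P1 0 = m0 \<and> P1 L = 0"
      using Q0 cont conv mono QM by (intro exI[of _ Q] exI[of _ P] exI[of _ "\<lambda>y. m y * P y"]) (auto simp: P_def)
  qed
qed

lemma pendant_potential:
  assumes G: "compact_metric_graph G" and a: "pendant_edge G a"
    and Q: "Q 0 = 0" "continuous_on {0..elen G (fst a)} Q" "convex_on {0..elen G (fst a)} Q"
      "mono_on {0..elen G (fst a)} Q" "\<And>y. y \<in> {0..elen G (fst a)} \<Longrightarrow> Q y \<le> M" and M: "0 \<le> M"
  shows "pendant_function G a Q \<in> convex_potentials G M"
    and "continuous_potential G (pendant_function G a Q)"
proof -
  let ?L = "elen G (fst a)" and ?q = "pendant_function G a Q"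
  have L: "\<And>e. e \<in> edges G \<Longrightarrow> 0 < elen G e" using G by (simp add: compact_metric_graph_def)
  have ea: "fst a \<in> edges G" using a by (simp add: pendant_edge_def)
  have Q0: "0 \<le> Q y" if "y \<in> {0..?L}" for y
    using mono_onD[OF Q(4), of 0 y] that Q(1) by simp
  have bounds: "0 \<le> ?q p \<and> ?q p \<le> M" if "p \<in> graph_points G" for p
    using that Q0 Q(5) M by (auto simp: pendant_function_def graph_points_def)
  have glued: "glued G ?q"
    unfolding glued_def
  proof (intro exI[of _ "\<lambda>v. if v = dstop G a then Q ?L else 0"] ballI)
    fix e assume e: "e \<in> edges G"
    show "?q (e, 0) = (if src G e = dstop G a then Q ?L else 0) \<and>
        ?q (e, elen G e) = (if tgt G e = dstop G a then Q ?L else 0)"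
    proof (cases "e = fst a")
      case True
      then show ?thesis using a Q(1)
        by (cases "snd a") (auto simp: pendant_function_def pendant_edge_def dstart_def dstop_def)
    next
      case False
      then show ?thesis using pendant_edge_other_ends[OF a e] by (simp add: pendant_function_def)
    qed
  qed
  have conv: "convex_on {0..walk_length G p} (\<lambda>t. ?q (walk_point G p t))"
    if "v \<noteq> w \<and> simple_walk G v p w" for v w p
  proof (rule pendant_function_convex_on_walk[OF L a Q(1,3,4) conjunct2[OF that]])
    show "p \<noteq> []" using that by (auto simp: simple_walk_def)
  qed
  show "?q \<in> convex_potentials G M"
    unfolding convex_potentials_def mem_Collect_eq
    by (intro conjI ballI allI impI glued bounds[THEN conjunct1] bounds[THEN conjunct2])
      (assumption | rule conv)+
  show "continuous_potential G ?q"
    unfolding continuous_potential_def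
  proof
    fix e assume "e \<in> edges G"
    have "continuous_on {0..?L} (\<lambda>x. Q (?L - x))"
      by (rule continuous_on_compose2[OF Q(2)]) (auto intro!: continuous_intros)
    then show "continuous_on {0..elen G e} (\<lambda>x. ?q (e, x))"
      using Q(2) by (cases "e = fst a"; cases "snd a") (simp_all add: pendant_function_def)
  qed
qed

text \<open>
  The two pieces fit together: \<open>P 0 = 1\<close> makes the function continuous at the inner vertex, the last
  hypothesis keeps the slope of the network solution there, and \<open>P1 = 0\<close> at the leaf is the
  vertex condition there, the only one that the network solution may violate.
\<close>

lemma pendant_ground_state:
  assumes G: "compact_metric_graph G" and a: "pendant_edge G a"
    and k: "0 < k" "\<And>e. e \<in> edges G \<Longrightarrow> k * elen G e < pi"
    and \<phi>: "\<And>v. v \<in> vertices G \<Longrightarrow> 0 < \<phi> v"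
    and F: "\<And>v. v \<in> vertices G \<Longrightarrow> v \<noteq> dstop G a \<Longrightarrow> normal_derivative_sum G (sine_network1 G k \<phi>) v = 0"
    and P: "ode_solution (elen G (fst a)) (\<lambda>y. Q y - k\<^sup>2) P P1" "\<And>y. 0 < P y" "P 0 = 1" "P1 (elen G (fst a)) = 0"
    and P10: "\<phi> (dstart G a) * P1 0 = (if snd a then sine_network1 G k \<phi> (fst a, 0)
        else - sine_network1 G k \<phi> (fst a, elen G (fst a)))"
  obtains f f1 where "eigenfunction G (pendant_function G a Q) (k\<^sup>2) f f1"
    "\<And>p. p \<in> graph_points G \<Longrightarrow> 0 < f p"
proof -
  let ?L = "elen G (fst a)" and ?q = "pendant_function G a Q"
  let ?c = "\<phi> (dstart G a)" and ?z = "dstop G a"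
  have L: "\<And>e. e \<in> edges G \<Longrightarrow> 0 < elen G e" using G by (simp add: compact_metric_graph_def)
  have ea: "fst a \<in> edges G" using a by (simp add: pendant_edge_def)
  have ends: "src G e \<in> vertices G" "tgt G e \<in> vertices G" if "e \<in> edges G" for e
    using that by (auto simp: vertices_def)
  have c: "0 < ?c" using \<phi> ends[OF ea] by (simp add: dstart_def)
  have sin: "sin (k * elen G e) \<noteq> 0" if "e \<in> edges G" for e
    using sin_gt_zero[of "k * elen G e"] L[OF that] k(1) k(2)[OF that] by simp
  define f where "f p = (if fst p = fst a then ?c * P (if snd a then snd p else ?L - snd p)
      else sine_interp k (elen G (fst p)) (\<phi> (src G (fst p))) (\<phi> (tgt G (fst p))) (snd p))" for p
  define f1 where "f1 p = (if fst p = fst a then (if snd a then ?c * P1 (snd p) else ?c * - P1 (?L - snd p))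
      else sine_network1 G k \<phi> p)" for p
  have "glued G f"
    unfolding glued_def
  proof (intro exI[of _ "\<phi>(?z := ?c * P ?L)"] ballI)
    fix e assume e: "e \<in> edges G"
    show "f (e, 0) = (\<phi>(?z := ?c * P ?L)) (src G e) \<and> f (e, elen G e) = (\<phi>(?z := ?c * P ?L)) (tgt G e)"
    proof (cases "e = fst a")
      case True
      then show ?thesis using a P(3)
        by (cases "snd a") (auto simp: f_def pendant_edge_def dstart_def dstop_def)
    next
      case False
      then show ?thesis using pendant_edge_other_ends[OF a e] sine_interp_ends[OF sin[OF e]] by (simp add: f_def)
    qed
  qed
  moreover have "ode_solution (elen G e) (\<lambda>x. ?q (e, x) - k\<^sup>2) (\<lambda>x. f (e, x)) (\<lambda>x. f1 (e, x))"
    if e: "e \<in> edges G" for e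
  proof (cases "e = fst a")
    case True
    show ?thesis
    proof (cases "snd a")
      case T: True
      then show ?thesis using ode_solution_scale[OF P(1), of ?c] True
        by (simp add: f_def f1_def pendant_function_def)
    next
      case F: False
      then show ?thesis using ode_solution_scale[OF ode_solution_reflect[OF P(1)], of ?c] True
        by (simp add: f_def f1_def pendant_function_def)
    qed
  next
    case False
    then show ?thesis using ode_solution_sine_interp[of "elen G e" k "\<phi> (src G e)" "\<phi> (tgt G e)"]
      by (simp add: f_def f1_def pendant_function_def sine_network1_def)
  qed
  moreover have "normal_derivative_sum G f1 v = 0" if v: "v \<in> vertices G" for v
  proof (cases "v = ?z")
    case True
    then show ?thesis using P(4) by (simp add: normal_derivative_sum_pendant[OF a] f1_def)
  next
    case False
    have "normal_derivative_sum G f1 v = normal_derivative_sum G (sine_network1 G k \<phi>) v"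
    proof (rule normal_derivative_sum_cong)
      fix e assume e: "e \<in> edges G" "src G e = v"
      have "snd a" if "e = fst a" using e(2) that False by (auto simp: dstop_def split: if_splits)
      then show "f1 (e, 0) = sine_network1 G k \<phi> (e, 0)" using P10 by (auto simp: f1_def)
    next
      fix e assume e: "e \<in> edges G" "tgt G e = v"
      have "\<not> snd a" if "e = fst a" using e(2) that False by (auto simp: dstop_def split: if_splits)
      then show "f1 (e, elen G e) = sine_network1 G k \<phi> (e, elen G e)" using P10 by (auto simp: f1_def)
    qed
    then show ?thesis using F[OF v False] by simp
  qed
  ultimately have "eigenfunction G ?q (k\<^sup>2) f f1" by (simp add: eigenfunction_def)
  moreover have "0 < f p" if "p \<in> graph_points G" for p
  proof -
    have p: "fst p \<in> edges G" "snd p \<in> {0..elen G (fst p)}" using that by (auto simp: graph_points_def)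
    show ?thesis
      using sine_interp_pos[OF k(1) L[OF p(1)] k(2)[OF p(1)] \<phi>[OF ends(1)[OF p(1)]] \<phi>[OF ends(2)[OF p(1)]] p(2)] c P(2)
      by (simp add: f_def)
  qed
  ultimately show thesis using that by blast
qed

text \<open>
  The slope of the network solution into the pendant edge, at its inner vertex, is minus the total
  leakage of the other edges. So it is nonpositive and tends to \<open>0\<close> with \<open>k\<close>, as
  \<open>pendant_edge_potential\<close> demands of \<open>m0\<close>.
\<close>

lemma convex_potential_with_low_ground_state:
  assumes G: "compact_metric_graph G" and a: "pendant_edge G a" and M: "0 < M" and \<Lambda>: "0 < \<Lambda>"
  obtains Q \<nu> f f1 where "pendant_function G a Q \<in> convex_potentials G M"
    "continuous_potential G (pendant_function G a Q)" "0 < \<nu>" "\<nu> < \<Lambda>"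
    "eigenfunction G (pendant_function G a Q) \<nu> f f1" "\<And>p. p \<in> graph_points G \<Longrightarrow> 0 < f p"
proof -
  let ?L = "elen G (fst a)" and ?z = "dstop G a" and ?y = "dstart G a"
  have fin: "finite (edges G)" and L: "\<And>e. e \<in> edges G \<Longrightarrow> 0 < elen G e"
    using G by (auto simp: compact_metric_graph_def)
  have ea: "fst a \<in> edges G" using a by (simp add: pendant_edge_def)
  have zy: "?z \<in> vertices G" "?y \<in> vertices G" using ea by (auto simp: vertices_def dstop_def dstart_def)
  obtain \<epsilon> where \<epsilon>: "0 < \<epsilon>" and pot: "\<And>\<nu> m0. 0 < \<nu> \<Longrightarrow> \<nu> < \<epsilon> \<Longrightarrow> - \<epsilon> < m0 \<Longrightarrow> m0 \<le> 0 \<Longrightarrow>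
      \<exists>Q P P1. Q 0 = 0 \<and> continuous_on {0..?L} Q \<and> convex_on {0..?L} Q \<and> mono_on {0..?L} Q \<and> (\<forall>y\<in>{0..?L}. Q y \<le> M) \<and>
        ode_solution ?L (\<lambda>y. Q y - \<nu>) P P1 \<and> (\<forall>y. 0 < P y) \<and> P 0 = 1 \<and> P1 0 = m0 \<and> P1 ?L = 0"
    by (rule pendant_edge_potential[OF L[OF ea] M]) (rule that)
  \<comment> \<open>the leakages enter with the factor \<open>\<phi> (src G e) + \<phi> (tgt G e) \<le> 2\<close>, and division by
    \<open>\<phi> (dstart G a) \<ge> 1 / 2\<close> doubles them again\<close>
  have "0 < min (\<epsilon> / 4) \<Lambda>" using \<epsilon> \<Lambda> by simp
  from eventually_conj[OF low_frequency_network[OF G zy(1) this] eventually_at_right_less[of 0]]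
  obtain k where k: "k\<^sup>2 < min (\<epsilon> / 4) \<Lambda>" "0 < k" and kL: "\<And>e. e \<in> edges G \<Longrightarrow> k * elen G e < pi"
    and S: "(\<Sum>e\<in>edges G. leakage k (elen G e)) < min (\<epsilon> / 4) \<Lambda>"
    and ex: "\<exists>\<phi>. (\<forall>v\<in>vertices G. 1 / 2 \<le> \<phi> v \<and> \<phi> v \<le> 1) \<and>
      (\<forall>v\<in>vertices G. v \<noteq> ?z \<longrightarrow> normal_derivative_sum G (sine_network1 G k \<phi>) v = 0)"
    by (auto dest!: eventually_happens simp: trivial_limit_at_right_real)
  from ex obtain \<phi> where \<phi>: "\<And>v. v \<in> vertices G \<Longrightarrow> 1 / 2 \<le> \<phi> v \<and> \<phi> v \<le> 1"
    and F: "\<And>v. v \<in> vertices G \<Longrightarrow> v \<noteq> ?z \<Longrightarrow> normal_derivative_sum G (sine_network1 G k \<phi>) v = 0"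
    by blast
  let ?d = "\<lambda>e. leakage k (elen G e)" and ?g = "sine_network1 G k \<phi>"
  define D where "D = (if snd a then ?g (fst a, 0) else - ?g (fst a, ?L))"
  have d: "0 \<le> ?d e" if "e \<in> edges G" for e
    using sin_gt_zero[of "k * elen G e"] L[OF that] k(2) kL[OF that] by (simp add: leakage_def)
  have "normal_derivative_sum G ?g ?z = (\<Sum>e\<in>edges G. ?d e * (\<phi> (src G e) + \<phi> (tgt G e)))"
    by (rule sine_network_almost_constant(2)[OF G k(2) kL zy(1) _ F ea]) (use \<phi> in fastforce)+
  moreover have "D + normal_derivative_sum G ?g ?z = ?d (fst a) * (\<phi> (src G (fst a)) + \<phi> (tgt G (fst a)))"
    unfolding normal_derivative_sum_pendant[OF a] D_def
    by (simp add: sine_network1_def sine_interp1_ends[of k ?L] algebra_simps)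
  moreover have "(\<Sum>e\<in>edges G. ?d e * (\<phi> (src G e) + \<phi> (tgt G e))) =
      ?d (fst a) * (\<phi> (src G (fst a)) + \<phi> (tgt G (fst a))) +
      (\<Sum>e\<in>edges G - {fst a}. ?d e * (\<phi> (src G e) + \<phi> (tgt G e)))"
    using fin ea by (rule sum.remove)
  ultimately have D: "D = - (\<Sum>e\<in>edges G - {fst a}. ?d e * (\<phi> (src G e) + \<phi> (tgt G e)))" by linarith
  have b: "0 \<le> \<phi> (src G e) + \<phi> (tgt G e)" "\<phi> (src G e) + \<phi> (tgt G e) \<le> 2" if "e \<in> edges G" for e
  proof -
    have "src G e \<in> vertices G" "tgt G e \<in> vertices G" using that by (auto simp: vertices_def)
    from \<phi>[OF this(1)] \<phi>[OF this(2)]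
    show "0 \<le> \<phi> (src G e) + \<phi> (tgt G e)" "\<phi> (src G e) + \<phi> (tgt G e) \<le> 2" by linarith+
  qed
  have "0 \<le> (\<Sum>e\<in>edges G - {fst a}. ?d e * (\<phi> (src G e) + \<phi> (tgt G e)))"
    using b d by (intro sum_nonneg mult_nonneg_nonneg) auto
  then have D0: "D \<le> 0" using D by simp
  have "(\<Sum>e\<in>edges G - {fst a}. ?d e * (\<phi> (src G e) + \<phi> (tgt G e))) \<le> (\<Sum>e\<in>edges G - {fst a}. ?d e * 2)"
    using b d by (intro sum_mono mult_left_mono) auto
  also have "\<dots> \<le> (\<Sum>e\<in>edges G. ?d e * 2)" using fin d by (intro sum_mono2) auto
  finally have D1: "- (\<epsilon> / 2) < D" using S D by (simp add: sum_distrib_right[symmetric])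
  have \<phi>y: "1 / 2 \<le> \<phi> ?y" using \<phi>[OF zy(2)] by simp
  then have m0: "- \<epsilon> < D / \<phi> ?y" "D / \<phi> ?y \<le> 0"
  proof -
    have "\<epsilon> * (1 / 2) \<le> \<epsilon> * \<phi> ?y" using \<epsilon> \<phi>y by (intro mult_left_mono) auto
    then have "- \<epsilon> * \<phi> ?y < D" using D1 by simp
    then show "- \<epsilon> < D / \<phi> ?y" using \<phi>y by (simp add: pos_less_divide_eq)
    show "D / \<phi> ?y \<le> 0" using D0 \<phi>y by (simp add: divide_nonpos_pos)
  qed
  obtain Q P P1 where Q: "Q 0 = 0" "continuous_on {0..?L} Q" "convex_on {0..?L} Q" "mono_on {0..?L} Q"
      "\<And>y. y \<in> {0..?L} \<Longrightarrow> Q y \<le> M"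
    and P: "ode_solution ?L (\<lambda>y. Q y - k\<^sup>2) P P1" "\<And>y. 0 < P y" "P 0 = 1" "P1 ?L = 0"
    and P10: "P1 0 = D / \<phi> ?y"
  proof -
    have "0 < k\<^sup>2" "k\<^sup>2 < \<epsilon>" using k \<epsilon> by auto
    from pot[OF this m0] that show thesis by blast
  qed
  have pos: "\<And>v. v \<in> vertices G \<Longrightarrow> 0 < \<phi> v" using \<phi> by fastforce
  have "\<phi> ?y * P1 0 = D" using P10 \<phi>y by simp
  then have slope: "\<phi> ?y * P1 0 = (if snd a then ?g (fst a, 0) else - ?g (fst a, ?L))"
    by (simp only: D_def)
  obtain f f1 where "eigenfunction G (pendant_function G a Q) (k\<^sup>2) f f1"
    "\<And>p. p \<in> graph_points G \<Longrightarrow> 0 < f p"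
    using pendant_ground_state[OF G a k(2) kL pos F P slope] by blast
  with that[of Q "k\<^sup>2" f f1] pendant_potential[OF G a Q less_imp_le[OF M]] k show thesis by simp
qed

section \<open>The gap at the zero potential\<close>

theorem corollary5p4:
  fixes G :: "('v, 'e) metric_graph" and M :: real
  assumes "metric_tree G"
    and "eigen_mult G (\<lambda>_. 0) (eigenval G (\<lambda>_. 0) 2) \<ge> 2"
    and "M > 0"
  shows "\<not> is_arg_min (spectral_gap G) (\<lambda>q. q \<in> convex_potentials G M) (\<lambda>_. 0)"
proof -
  let ?\<Lambda> = "eigenval G (\<lambda>_. 0) 2"
  have G: "compact_metric_graph G" using assms(1) by (simp add: metric_tree_def)
  then have fin: "finite (edges G)" and L: "\<And>e. e \<in> edges G \<Longrightarrow> 0 < elen G e"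
    by (auto simp: compact_metric_graph_def)
  obtain z where "z \<in> leaves G" using metric_tree_has_leaf[OF assms(1)] .
  then obtain a where a: "pendant_edge G a" "dstop G a = z" using leaf_pendant_edge[OF _ fin] by blast
  then have ea: "fst a \<in> edges G" by (simp add: pendant_edge_def)
  have zV: "dstop G a \<in> vertices G" using ea by (auto simp: vertices_def dstop_def)
  have c0: "continuous_potential G (\<lambda>_. 0)" by (simp add: continuous_potential_def)
  define x0 where "x0 = (if snd a then elen G (fst a) else 0)"
  have x0: "(fst a, x0) \<in> graph_points G" using ea L[OF ea] by (simp add: x0_def graph_points_def)
  obtain u where u: "u \<in> eigenspace G (\<lambda>_. 0) ?\<Lambda>" "u \<noteq> 0" "u (fst a, x0) = 0"
    using eigen_mult_2_vanishing[OF G c0 assms(2)] by metis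
  then obtain u1 where u1: "eigenfunction G (\<lambda>_. 0) ?\<Lambda> u u1"
    using eigenspace_iff_eigenfunction[OF G c0] by blast
  have "normal_derivative_sum G u1 (dstop G a) = 0" using u1 zV by (simp add: eigenfunction_def)
  then have "u1 (fst a, x0) = 0" by (simp add: normal_derivative_sum_pendant[OF a(1)] x0_def split: if_splits)
  then have vanish: "u (fst a, x) = 0" if "x \<in> {0..elen G (fst a)}" for x
    using eigenfunction_zero_initial_data[OF c0 u1, of "fst a" x] u(3) that ea
    by (auto simp: x0_def graph_points_def split: if_splits)
  have one: "eigenfunction G (\<lambda>_. 0) 0 (\<lambda>_. 1) (\<lambda>_. 0)"
    by (auto simp: eigenfunction_def glued_def ode_solution_def normal_derivative_sum_def)
  have "0 < ?\<Lambda>"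
  proof (rule ccontr)
    assume "\<not> 0 < ?\<Lambda>"
    then have "u p = 0" if "p \<in> graph_points G" for p
      using ground_state_simple[OF G one _ u1 _ x0 u(3) that] by simp
    then have "u p = 0" for p using eigenspace_vanishes_outside[OF u(1)] by blast
    then show False using u(2) by (auto simp: fun_eq_iff)
  qed
  from convex_potential_with_low_ground_state[OF G a(1) assms(3) this]
  obtain Q \<nu> f f1 where q: "pendant_function G a Q \<in> convex_potentials G M"
      "continuous_potential G (pendant_function G a Q)" and \<nu>: "0 < \<nu>" "\<nu> < ?\<Lambda>"
    and f: "eigenfunction G (pendant_function G a Q) \<nu> f f1" "\<And>p. p \<in> graph_points G \<Longrightarrow> 0 < f p"
    by metis
  let ?q = "pendant_function G a Q"
  have "ode_solution (elen G e) (\<lambda>x. ?q (e, x) - ?\<Lambda>) (\<lambda>x. u (e, x)) (\<lambda>x. u1 (e, x))" if "e \<in> edges G" for e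
    using u1 that vanish by (cases "e = fst a") (auto simp: eigenfunction_def ode_solution_def pendant_function_def)
  then have "eigenfunction G ?q ?\<Lambda> u u1" using u1 by (simp add: eigenfunction_def)
  then have "u \<in> eigenspace G ?q ?\<Lambda>"
    using eigenspace_iff_eigenfunction[OF G q(2)] eigenspace_vanishes_outside[OF u(1)] by blast
  then have "0 < eigen_mult G ?q ?\<Lambda>" using eigen_mult_pos_iff[OF G q(2)] u(2) by blast
  then have "eigenval G ?q 2 \<le> ?\<Lambda>" using eigenval_2_le[OF G q(2) f] \<nu>(2) by blast
  moreover have "eigenval G ?q 1 = \<nu>" using eigenval_1_ground_state(2)[OF G q(2) f] by blast
  moreover have "eigenval G (\<lambda>_. 0) 1 = 0" using eigenval_1_ground_state(2)[OF G c0 one] by simp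
  ultimately have "spectral_gap G ?q < spectral_gap G (\<lambda>_. 0)" using \<nu> by (simp add: spectral_gap_def)
  then show ?thesis using q(1) by (auto simp: is_arg_min_def)
qed

end
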